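(* Every $4$-regular connected circulant graph $\Gamma$ of even order whose two jumps have different parity has property $Q_2$ with respect to some Hamilton cycle decomposition of it; that is, $\Gamma$ has a decomposition into two Hamilton cycles $H_1,H_2$ for which $\Gamma$ contains an odd alternating $4$-cycle.
   Context: A $4$-regular circulant of order $n$ is $Circ(n;\{a,b\})$ with vertex set $\mathbb{Z}_n$ and edges $x(x\pm a)$, $x(x\pm b)$, where $a,b$ (the jumps) are distinct elements of $\{1,\ldots,\lfloor n/2\rfloor\}$ with $2a\ne0$, $2b\neq0$ in $\mathbb{Z}_n$. For a decomposition $\{H_1,H_2\}$ of a $4$-regular graph of even order into two Hamilton cycles, a $4$-cycle $(w\,x\,y\,z)$ is alternating if $wx,yz$ lie in one of $H_1,H_2$ and $xy,zw$ in the other; it is an odd alternating $4$-cycle if moreover $w$ and $y$ (or $x$ and $z$) are at odd distance along each of $H_1$ and $H_2$. Property $Q_2$ means such an odd alternating $4$-cycle exists. *)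

theory Defs
  imports "HOL-Number_Theory.Cong"
begin

text \<open>
  A finite simple graph is a pair of a vertex set and a set of edges, each edge being an
  unordered pair \<open>{u, v}\<close>. Spanning subgraphs, such as Hamilton cycles, are given by their
  edge sets.
\<close>

type_synonym 'a graph = "'a set \<times> 'a set set"

abbreviation verts :: "'a graph \<Rightarrow> 'a set" where
  "verts \<equiv> fst"

abbreviation edges :: "'a graph \<Rightarrow> 'a set set" where
  "edges \<equiv> snd"

definition adj :: "'a set set \<Rightarrow> ('a \<times> 'a) set" where
  "adj E = {(u, v). {u, v} \<in> E}"

definition connected_graph :: "'a graph \<Rightarrow> bool" where
  "connected_graph G \<longleftrightarrow> (\<forall>u\<in>verts G. \<forall>v\<in>verts G. (u, v) \<in> (adj (edges G))\<^sup>*)"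

text \<open>
  The usual graph distance; it is meaningful only for vertices joined by a path in \<open>E\<close>.
\<close>

definition graph_dist :: "'a set set \<Rightarrow> 'a \<Rightarrow> 'a \<Rightarrow> nat" where
  "graph_dist E u v = (LEAST k. (u, v) \<in> adj E ^^ k)"

definition cycle_edges :: "'a list \<Rightarrow> 'a set set" where
  "cycle_edges vs = {{vs ! i, vs ! (Suc i mod length vs)} | i. i < length vs}"

definition hamilton_cycle :: "'a graph \<Rightarrow> 'a set set \<Rightarrow> bool" where
  "hamilton_cycle G H \<longleftrightarrow>
     (\<exists>vs. distinct vs \<and> length vs \<ge> 3 \<and> set vs = verts G \<and> H = cycle_edges vs \<and> H \<subseteq> edges G)"

definition hamilton_decomposition :: "'a graph \<Rightarrow> 'a set set \<Rightarrow> 'a set set \<Rightarrow> bool" where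
  "hamilton_decomposition G H1 H2 \<longleftrightarrow>
     hamilton_cycle G H1 \<and> hamilton_cycle G H2 \<and> H1 \<inter> H2 = {} \<and> H1 \<union> H2 = edges G"

definition four_cycle :: "'a graph \<Rightarrow> 'a \<Rightarrow> 'a \<Rightarrow> 'a \<Rightarrow> 'a \<Rightarrow> bool" where
  "four_cycle G w x y z \<longleftrightarrow>
     distinct [w, x, y, z] \<and> {w, x, y, z} \<subseteq> verts G \<and>
     {w, x} \<in> edges G \<and> {x, y} \<in> edges G \<and> {y, z} \<in> edges G \<and> {z, w} \<in> edges G"

definition alternating_4_cycle ::
  "'a graph \<Rightarrow> 'a set set \<Rightarrow> 'a set set \<Rightarrow> 'a \<Rightarrow> 'a \<Rightarrow> 'a \<Rightarrow> 'a \<Rightarrow> bool" where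
  "alternating_4_cycle G H1 H2 w x y z \<longleftrightarrow>
     four_cycle G w x y z \<and>
     ({w, x} \<in> H1 \<and> {y, z} \<in> H1 \<and> {x, y} \<in> H2 \<and> {z, w} \<in> H2 \<or>
      {w, x} \<in> H2 \<and> {y, z} \<in> H2 \<and> {x, y} \<in> H1 \<and> {z, w} \<in> H1)"

text \<open>
  On a Hamilton cycle of a graph of even order the two arcs between two vertices have lengths
  of equal parity, so taking the shorter one (the graph distance in the cycle) is no restriction.
\<close>

definition odd_alternating_4_cycle ::
  "'a graph \<Rightarrow> 'a set set \<Rightarrow> 'a set set \<Rightarrow> 'a \<Rightarrow> 'a \<Rightarrow> 'a \<Rightarrow> 'a \<Rightarrow> bool" where
  "odd_alternating_4_cycle G H1 H2 w x y z \<longleftrightarrow>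
     alternating_4_cycle G H1 H2 w x y z \<and>
     (odd (graph_dist H1 w y) \<and> odd (graph_dist H2 w y) \<or>
      odd (graph_dist H1 x z) \<and> odd (graph_dist H2 x z))"

definition property_Q2 :: "'a graph \<Rightarrow> 'a set set \<Rightarrow> 'a set set \<Rightarrow> bool" where
  "property_Q2 G H1 H2 \<longleftrightarrow> (\<exists>w x y z. odd_alternating_4_cycle G H1 H2 w x y z)"

text \<open>The residues modulo \<open>n\<close> are represented by \<open>0, \<dots>, n - 1\<close>.\<close>

definition Circ :: "nat \<Rightarrow> nat set \<Rightarrow> nat graph" where
  "Circ n S =
     ({0..<n},
      {{x, y} | x y. x < n \<and> y < n \<and> (\<exists>j\<in>S. [y = x + j] (mod n) \<or> [x = y + j] (mod n))})"

definition four_regular_jumps :: "nat \<Rightarrow> nat \<Rightarrow> nat \<Rightarrow> bool" where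
  "four_regular_jumps n a b \<longleftrightarrow>
     a \<in> {1..n div 2} \<and> b \<in> {1..n div 2} \<and> a \<noteq> b \<and>
     \<not> [2 * a = 0] (mod n) \<and> \<not> [2 * b = 0] (mod n)"

end

theory Submission
  imports Defs
begin

text \<open>
  Let \<open>a\<close> be the odd and \<open>b\<close> the even jump. The \<open>a\<close>-edges form \<open>c = gcd a n\<close> cycles and the
  \<open>b\<close>-edges form \<open>d = gcd b n\<close> cycles, where \<open>c\<close> is odd and \<open>d\<close> is even. Switching a square
  \<open>x, x + a, x + a + b, x + b\<close> exchanges its \<open>a\<close>-edges with its \<open>b\<close>-edges between the two
  2-factors, so for pairwise edge-disjoint squares both 2-factors stay 2-regular and it remains to
  make them connected. A staircase of squares, one between any two consecutive \<open>b\<close>-cycles, merges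
  all \<open>b\<close>-cycles; a cyclic staircase, which also joins the last \<open>a\<close>-cycle to the first one, merges
  the \<open>a\<close>-cycles because their number is odd. If \<open>c\<close> and \<open>d\<close> are far apart, the shorter staircase
  is prolonged by a zigzag: three consecutive squares at heights \<open>k, k - 1, k\<close> act on the crossing
  cycles like a single square.

  Let \<open>m = n / d\<close>. If \<open>m\<close> is odd, or if \<open>d = 2 < c\<close>, then the switched square at \<open>0\<close> is an odd
  alternating 4-cycle; otherwise an unswitched square between the last and the first \<open>b\<close>-cycle
  is one. For \<open>c = 1\<close> and for \<open>d = 2\<close> this may require replacing \<open>b\<close> by \<open>- b\<close>.
\<close>

section \<open>Cycles as connected two-regular graphs\<close>

text \<open>Switching acts on both 2-factors at once, so a single set of squares has to merge two
  families of cycles of different sizes. A diagonal staircase can serve both, because it looks the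
  same from either family: its \<open>g\<close>-th square lies in column \<open>g\<close> at height
  \<open>g\<close>. The \<open>b\<close>-cycles call for a path of \<open>d - 1\<close> squares and
  the \<open>a\<close>-cycles for a closed round of \<open>c\<close> squares. Both numbers are odd,
  so they differ by an even number, and zigzags, which add squares in pairs, can make up the
  difference.

  Distances are never computed. A Hamilton cycle of even length is bipartite, so any walk between
  opposite corners of a square shows the parity of their distance; walks therefore record a parity
  and no length. Except when \<open>d = 2 < c\<close>, no square lies between the last and the first
  \<open>b\<close>-cycle. For even \<open>m\<close> this gap gives a 2-colouring, which yields the
  parity in the \<open>b\<close>-factor without following its Hamilton cycle.\<close>

lemma cycle_of_two_regular:
  fixes H :: "'a set set"
  assumes fin: "finite V" and ne: "V \<noteq> {}"
    and nb: "\<And>x. x \<in> V \<Longrightarrow> \<exists>y z. y \<noteq> z \<and> y \<noteq> x \<and> z \<noteq> x \<and> y \<in> V \<and> z \<in> V \<and> (\<forall>w. {x, w} \<in> H \<longleftrightarrow> w = y \<or> w = z)"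
    and edg: "\<And>e. e \<in> H \<Longrightarrow> \<exists>x y. e = {x, y} \<and> x \<in> V"
    and conn: "\<And>x y. x \<in> V \<Longrightarrow> y \<in> V \<Longrightarrow> (x, y) \<in> (adj H)\<^sup>*"
  shows "\<exists>vs. distinct vs \<and> length vs \<ge> 3 \<and> set vs = V \<and> H = cycle_edges vs"
proof -
  define path where "path vs \<longleftrightarrow> distinct vs \<and> set vs \<subseteq> V \<and> (\<forall>i. Suc i < length vs \<longrightarrow> {vs ! i, vs ! Suc i} \<in> H)" for vs
  have two: "w3 = w1 \<or> w3 = w2" if "x \<in> V" "{x, w1} \<in> H" "{x, w2} \<in> H" "w1 \<noteq> w2" "{x, w3} \<in> H" for x w1 w2 w3
    using nb[OF that(1)] that(2-) by metis
  have bound: "length vs \<le> card V" if "path vs" for vs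
    using that fin by (metis path_def card_mono distinct_card)
  have "\<exists>vs. path vs \<and> length vs = 3"
  proof -
    obtain x where x: "x \<in> V" using ne by blast
    then obtain y z where yz: "y \<noteq> z" "y \<noteq> x" "z \<noteq> x" "y \<in> V" "z \<in> V" "{x, y} \<in> H" "{x, z} \<in> H"
      using nb by metis
    have "path [y, x, z]"
      unfolding path_def using x yz by (auto simp: less_Suc_eq insert_commute)
    then show ?thesis by (intro exI[of _ "[y, x, z]"]) simp
  qed
  then obtain vs0 where vs0: "path vs0" "length vs0 = 3" by blast
  \<comment> \<open>A longest path: it cannot be extended, so all neighbours of its last vertex lie
    on it.\<close>
  obtain vs where vs: "path vs" and max: "\<And>us. path us \<Longrightarrow> length us \<le> length vs"
    using ex_has_greatest_nat[of path vs0 length "Suc (card V)"] vs0 bound by (metis less_Suc_eq_le)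
  define k where "k = length vs"
  have k3: "3 \<le> k" using max[OF vs0(1)] vs0(2) by (simp add: k_def)
  have d: "distinct vs" and sub: "set vs \<subseteq> V" and st: "\<And>i. Suc i < k \<Longrightarrow> {vs ! i, vs ! Suc i} \<in> H"
    using vs by (auto simp: path_def k_def)
  have inj: "vs ! i = vs ! j \<longleftrightarrow> i = j" if "i < k" "j < k" for i j
    using that d by (simp add: k_def nth_eq_iff_index_eq)
  have inV: "vs ! i \<in> V" if "i < k" for i using that sub by (auto simp: k_def)
  have ext: "w \<in> set vs" if "{vs ! (k - 1), w} \<in> H" for w
  proof (rule ccontr)
    assume w: "w \<notin> set vs"
    obtain y z where "y \<in> V" "z \<in> V" "w = y \<or> w = z" using nb[OF inV[of "k - 1"]] k3 \<open>{vs ! (k - 1), w} \<in> H\<close> by auto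
    then have "w \<in> V" by auto
    have "path (vs @ [w])" unfolding path_def
    proof (intro conjI allI impI)
      fix i assume "Suc i < length (vs @ [w])"
      then have "Suc i < k \<or> i = k - 1" using k3 by (auto simp: k_def)
      then consider "Suc i < k" | "i = k - 1" by blast
      then show "{(vs @ [w]) ! i, (vs @ [w]) ! Suc i} \<in> H"
      proof cases
        case 1
        then show ?thesis using st[OF 1] by (simp add: nth_append k_def)
      next
        case 2
        then have "i < length vs" "Suc i = length vs" using k3 by (auto simp: k_def)
        then show ?thesis using that 2 by (simp add: nth_append)
      qed
    qed (use d w sub \<open>w \<in> V\<close> in auto)
    then show False using max[of "vs @ [w]"] by simp
  qed
  have close: "{vs ! (k - 1), vs ! 0} \<in> H"
  proof -
    have pre: "{vs ! (k - 1), vs ! (k - 2)} \<in> H"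
      using st[of "k - 2"] k3 by (simp add: insert_commute numeral_2_eq_2 Suc_diff_Suc)
    obtain y z where yz: "y \<noteq> z" "y \<noteq> vs ! (k - 1)" "z \<noteq> vs ! (k - 1)" "{vs ! (k - 1), y} \<in> H" "{vs ! (k - 1), z} \<in> H"
      using nb[OF inV[of "k - 1"]] k3 by auto
    then obtain w where w: "{vs ! (k - 1), w} \<in> H" "w \<noteq> vs ! (k - 2)" "w \<noteq> vs ! (k - 1)" by metis
    then obtain i where i: "i < k" "w = vs ! i" using ext by (metis in_set_conv_nth k_def)
    then have "i \<noteq> k - 1" "i \<noteq> k - 2" using w by auto
    \<comment> \<open>An inner vertex already has two neighbours on the path, and the last vertex
      would be a third.\<close>
    have "i = 0"
    proof (rule ccontr)
      assume "i \<noteq> 0"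
      have ik: "Suc i < k - 1" using i \<open>i \<noteq> k - 1\<close> \<open>i \<noteq> k - 2\<close> by simp
      have "{vs ! i, vs ! (i - 1)} \<in> H" using st[of "i - 1"] \<open>i \<noteq> 0\<close> i by (simp add: insert_commute)
      moreover have "{vs ! i, vs ! Suc i} \<in> H" using st[of i] ik by simp
      moreover have "{vs ! i, vs ! (k - 1)} \<in> H" using w i by (simp add: insert_commute)
      moreover have "vs ! (i - 1) \<noteq> vs ! Suc i" using inj[of "i - 1" "Suc i"] ik by simp
      ultimately have "vs ! (k - 1) = vs ! (i - 1) \<or> vs ! (k - 1) = vs ! Suc i"
        using two[OF inV[OF i(1)]] by blast
      then show False using inj[of "k - 1" "i - 1"] inj[of "k - 1" "Suc i"] ik by auto
    qed
    then show ?thesis using w i by simp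
  qed
  have cyc: "{vs ! i, vs ! (Suc i mod k)} \<in> H" if "i < k" for i
  proof (cases "Suc i = k")
    case True
    then show ?thesis using close by auto
  next
    case False
    then show ?thesis using st[of i] that by simp
  qed
  define prv where "prv i = (if i = 0 then k - 1 else i - 1)" for i
  have prv: "prv i < k" "Suc (prv i) mod k = i" "prv i \<noteq> Suc i mod k" if "i < k" for i
    using that k3 by (auto simp: prv_def mod_Suc)
  have nbs: "w = vs ! (Suc i mod k) \<or> w = vs ! prv i" if "i < k" "{vs ! i, w} \<in> H" for i w
  proof -
    have "{vs ! i, vs ! prv i} \<in> H" using cyc[OF prv(1)[OF that(1)]] prv(2)[OF that(1)] by (simp add: insert_commute)
    moreover have "vs ! (Suc i mod k) \<noteq> vs ! prv i"
      using inj[of "Suc i mod k" "prv i"] prv[OF that(1)] that(1) by auto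
    ultimately show ?thesis using two[OF inV[OF that(1)] cyc[OF that(1)]] that(2) by blast
  qed
  \<comment> \<open>Both neighbours of every vertex of the closed path lie on it, so connectedness
    leaves nothing outside.\<close>
  have "set vs = V"
  proof
    show "V \<subseteq> set vs"
    proof
      fix y assume "y \<in> V"
      have "vs ! 0 \<in> V" using inV[of 0] k3 by simp
      from conn[OF this \<open>y \<in> V\<close>] show "y \<in> set vs"
      proof (induction rule: rtrancl_induct)
        case base
        then show ?case using k3 by (auto simp: k_def intro!: nth_mem)
      next
        case (step x w)
        then obtain i where "i < k" "x = vs ! i" by (metis in_set_conv_nth k_def)
        moreover have "Suc i mod k < k" using k3 by simp
        ultimately show ?case using nbs[of i w] step(2) prv(1)[of i]
          by (auto simp: adj_def k_def intro!: nth_mem)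
      qed
    qed
  qed (rule sub)
  moreover have "H = cycle_edges vs"
  proof
    show "cycle_edges vs \<subseteq> H" using cyc by (auto simp: cycle_edges_def k_def)
    show "H \<subseteq> cycle_edges vs"
    proof
      fix e assume "e \<in> H"
      then obtain x y where e: "e = {x, y}" "x \<in> V" using edg by blast
      then obtain i where i: "i < k" "x = vs ! i" using \<open>set vs = V\<close> by (metis in_set_conv_nth k_def)
      then consider "y = vs ! (Suc i mod k)" | "y = vs ! prv i" using nbs[of i y] e \<open>e \<in> H\<close> by auto
      then show "e \<in> cycle_edges vs"
      proof cases
        case 1
        then show ?thesis using e i by (auto simp: cycle_edges_def k_def)
      next
        case 2
        then have "e = {vs ! prv i, vs ! (Suc (prv i) mod k)}" using e i prv(2) by (auto simp: insert_commute)
        then show ?thesis using prv(1)[OF i(1)] by (auto simp: cycle_edges_def k_def)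
      qed
    qed
  qed
  ultimately show ?thesis using d k3 k_def by blast
qed

text \<open>The parity of the position is a proper 2-colouring of an even cycle, so all walks
  between two vertices, shortest ones included, have the same parity.\<close>

lemma odd_graph_dist_cycle:
  assumes "distinct vs" "even (length vs)" "(x, y) \<in> adj (cycle_edges vs) ^^ k" "odd k"
  shows "odd (graph_dist (cycle_edges vs) x y)"
proof -
  define f where "f x \<longleftrightarrow> (\<exists>i<length vs. vs ! i = x \<and> even i)" for x
  have f: "f (vs ! i) \<longleftrightarrow> even i" if "i < length vs" for i
    using that assms(1) by (auto simp: f_def nth_eq_iff_index_eq)
  have edge: "f u \<noteq> f v" if uv: "(u, v) \<in> adj (cycle_edges vs)" for u v
  proof -
    obtain i where i: "i < length vs" "{u, v} = {vs ! i, vs ! (Suc i mod length vs)}"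
      using uv by (auto simp: adj_def cycle_edges_def)
    have "Suc i mod length vs < length vs" using i(1) by (metis mod_less_divisor gr_implies_not0 neq0_conv)
    moreover have "even (Suc i mod length vs) \<longleftrightarrow> odd i" using assms(2) by (simp add: dvd_mod_iff)
    ultimately have "f (vs ! i) \<noteq> f (vs ! (Suc i mod length vs))" using f i(1) by simp
    then show ?thesis using i(2) by (auto simp: doubleton_eq_iff)
  qed
  have walk: "f u = f v \<longleftrightarrow> even j" if "(u, v) \<in> adj (cycle_edges vs) ^^ j" for u v j
    using that
  proof (induction j arbitrary: v)
    case (Suc j)
    then obtain w where "(u, w) \<in> adj (cycle_edges vs) ^^ j" "(w, v) \<in> adj (cycle_edges vs)" by auto
    then show ?case using Suc.IH edge by auto
  qed simp
  have "(x, y) \<in> adj (cycle_edges vs) ^^ graph_dist (cycle_edges vs) x y"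
    unfolding graph_dist_def using assms(3) by (rule LeastI)
  then show ?thesis using walk assms(3,4) by blast
qed

section \<open>Walks after switching squares\<close>

text \<open>
  Residues modulo \<open>n\<close> are represented by arbitrary integers, and \<open>S\<close> contains the corners \<open>x\<close> of
  the switched squares \<open>x, x + u, x + u + v, x + v\<close>. So the \<open>u\<close>-edge at \<open>x\<close> is switched iff
  \<open>x \<in> S\<close> or \<open>x - v \<in> S\<close>, and the \<open>v\<close>-edge at \<open>x\<close> iff \<open>x \<in> S\<close> or \<open>x - u \<in> S\<close>. The last argument
  says whether the walk has odd length.
\<close>

inductive pwalk :: "int \<Rightarrow> int \<Rightarrow> int \<Rightarrow> int set \<Rightarrow> int \<Rightarrow> int \<Rightarrow> bool \<Rightarrow> bool"
  for n u v S where
  cong: "[x = y] (mod n) \<Longrightarrow> pwalk n u v S x y False"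
| straight: "x \<notin> S \<Longrightarrow> x - v \<notin> S \<Longrightarrow> pwalk n u v S x (x + u) True"
| cross: "x \<in> S \<or> x - u \<in> S \<Longrightarrow> pwalk n u v S x (x + v) True"
| sym: "pwalk n u v S x y p \<Longrightarrow> pwalk n u v S y x p"
| trans: "pwalk n u v S x y p \<Longrightarrow> pwalk n u v S y z q \<Longrightarrow> pwalk n u v S x z (p \<noteq> q)"

definition periodic :: "int \<Rightarrow> int set \<Rightarrow> bool" where
  "periodic n S \<longleftrightarrow> (\<forall>x y. [x = y] (mod n) \<longrightarrow> x \<in> S \<longrightarrow> y \<in> S)"

lemma periodicD: "periodic n S \<Longrightarrow> [x = y] (mod n) \<Longrightarrow> x \<in> S \<longleftrightarrow> y \<in> S"
  unfolding periodic_def using cong_sym by blast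

lemma pwalk_refl: "pwalk n u v S x x False"
  by (simp add: pwalk.cong)

lemma pwalk_cong:
  assumes "pwalk n u v S x y p" "[x = x'] (mod n)" "[y = y'] (mod n)"
  shows "pwalk n u v S x' y' p"
proof -
  have "pwalk n u v S x' x False" "pwalk n u v S y y' False"
    using assms(2,3) by (auto intro: pwalk.cong simp: cong_sym_eq)
  from pwalk.trans[OF pwalk.trans[OF this(1) assms(1)] this(2)] show ?thesis by simp
qed

lemma pwalk_run:
  assumes "\<And>i. i < t \<Longrightarrow> x + int i * u \<notin> S \<and> x + int i * u - v \<notin> S"
  shows "pwalk n u v S x (x + int t * u) (odd t)"
  using assms
proof (induction t)
  case 0
  then show ?case by (simp add: pwalk_refl)
next
  case (Suc t)
  have "pwalk n u v S x (x + int t * u) (odd t)" using Suc by simp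
  moreover have "pwalk n u v S (x + int t * u) (x + int t * u + u) True"
    using Suc.prems[of t] by (intro pwalk.straight) auto
  ultimately have "pwalk n u v S x (x + int t * u + u) (odd t \<noteq> True)" by (rule pwalk.trans)
  moreover have "x + int t * u + u = x + int (Suc t) * u" by (simp add: algebra_simps)
  ultimately show ?case by simp
qed

definition walk_connected :: "int \<Rightarrow> int \<Rightarrow> int \<Rightarrow> int set \<Rightarrow> bool" where
  "walk_connected n u v S \<longleftrightarrow> (\<forall>x y. \<exists>p. pwalk n u v S x y p)"

lemma walk_connectedI:
  assumes "\<And>x. \<exists>p. pwalk n u v S x t p"
  shows "walk_connected n u v S"
  unfolding walk_connected_def
proof (intro allI)
  fix x y
  obtain p q where "pwalk n u v S x t p" "pwalk n u v S y t q" using assms by metis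
  then have "pwalk n u v S x y (p \<noteq> q)" by (metis pwalk.sym pwalk.trans)
  then show "\<exists>p. pwalk n u v S x y p" ..
qed

text \<open>
  Adding the squares at \<open>z + u - v\<close> and \<open>z + 2 u\<close> to one at \<open>z\<close> cuts the vertices \<open>z + u\<close>,
  \<open>z + 2 u\<close>, \<open>z + u + v\<close>, \<open>z + 2 u + v\<close> out of their path and inserts them into the path along
  \<open>z - v\<close>. The map below collapses the old path onto the edge from \<open>z + 3 u\<close> to \<open>z + 3 u + v\<close> that
  replaces it, in such a way that every old edge is mapped to a walk of odd length.
\<close>

definition zigzag_map :: "int \<Rightarrow> int \<Rightarrow> int \<Rightarrow> int \<Rightarrow> int \<Rightarrow> int" where
  "zigzag_map n u v z x =
     (if [x = z + u] (mod n) \<or> [x = z + 2 * u + v] (mod n) then z + 3 * u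
      else if [x = z + 2 * u] (mod n) \<or> [x = z + u + v] (mod n) then z + 3 * u + v
      else x)"

context
  fixes n u v z :: int and S S' :: "int set"
  assumes per: "periodic n S" and zS: "z \<in> S"
    and S': "S' = S \<union> {x. [x = z + u - v] (mod n)} \<union> {x. [x = z + 2 * u] (mod n)}"
    and notin: "z - v \<notin> S" "z + v \<notin> S" "z + u \<notin> S" "z + u + v \<notin> S" "z + u - v \<notin> S"
      "z + 2 * u \<notin> S" "z + 2 * u + v \<notin> S" "z + 2 * u - v \<notin> S"
    and ndvd: "\<not> n dvd u" "\<not> n dvd v" "\<not> n dvd 2 * u" "\<not> n dvd 2 * v" "\<not> n dvd u - v" "\<not> n dvd u + v"
      "\<not> n dvd 2 * u - v" "\<not> n dvd 2 * u + v" "\<not> n dvd u + 2 * v"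
begin

lemma zigzag_new: "z + u - v \<in> S'" "z + 2 * u \<in> S'" "z \<in> S'" "S \<subseteq> S'"
  using zS by (auto simp: S')

text \<open>The first five edges form the path \<open>z + u - v\<close>, \<open>z + u\<close>,
  \<open>z + u + v\<close>, \<open>z + 2 * u + v\<close>, \<open>z + 2 * u\<close>,
  \<open>z + 2 * u - v\<close>, which takes the place of the \<open>u\<close>-edge between its ends.
  The sixth closes the gap left where the four inner vertices were cut out.\<close>

lemma zigzag_bypass:
  "pwalk n u v S' (z + u) (z + u - v) True"
  "pwalk n u v S' (z + u) (z + u + v) True"
  "pwalk n u v S' (z + u + v) (z + 2 * u + v) True"
  "pwalk n u v S' (z + 2 * u) (z + 2 * u + v) True"
  "pwalk n u v S' (z + 2 * u) (z + 2 * u - v) True"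
  "pwalk n u v S' (z + 3 * u) (z + 3 * u + v) True"
proof -
  have "pwalk n u v S' (z + u - v) (z + u - v + v) True"
    using zigzag_new by (intro pwalk.cross) auto
  then show "pwalk n u v S' (z + u) (z + u - v) True" by (simp add: pwalk.sym)
  show "pwalk n u v S' (z + u) (z + u + v) True"
    using zigzag_new by (intro pwalk.cross) auto
  have "\<not> [z + u + v = z + u - v] (mod n)" "\<not> [z + u + v = z + 2 * u] (mod n)"
     "\<not> [z + u = z + u - v] (mod n)" "\<not> [z + u = z + 2 * u] (mod n)"
    using ndvd by (auto simp: cong_iff_dvd_diff dvd_diff_commute)
  then have "z + u + v \<notin> S'" "z + u \<notin> S'" using notin by (auto simp: S')
  then have "pwalk n u v S' (z + u + v) (z + u + v + u) True"
    by (intro pwalk.straight) auto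
  then show "pwalk n u v S' (z + u + v) (z + 2 * u + v) True" by (simp add: algebra_simps)
  show "pwalk n u v S' (z + 2 * u) (z + 2 * u + v) True"
    using zigzag_new by (intro pwalk.cross) auto
  have "z + 2 * u - v - u = z + u - v" by simp
  then have "pwalk n u v S' (z + 2 * u - v) (z + 2 * u - v + v) True"
    using zigzag_new by (intro pwalk.cross disjI2) (simp only:)
  then show "pwalk n u v S' (z + 2 * u) (z + 2 * u - v) True" by (simp add: pwalk.sym)
  have "z + 3 * u - u = z + 2 * u" by simp
  then show "pwalk n u v S' (z + 3 * u) (z + 3 * u + v) True"
    using zigzag_new by (intro pwalk.cross disjI2) (simp only:)
qed

lemma zigzag_map_cong:
  "[x = y] (mod n) \<Longrightarrow> [zigzag_map n u v z x = zigzag_map n u v z y] (mod n)"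
  unfolding zigzag_map_def by (simp add: cong_def)

lemma zigzag_map_simps:
  "zigzag_map n u v z (z + u) = z + 3 * u"
  "zigzag_map n u v z (z + 2 * u + v) = z + 3 * u"
  "zigzag_map n u v z (z + 2 * u) = z + 3 * u + v"
  "zigzag_map n u v z (z + u + v) = z + 3 * u + v"
  "zigzag_map n u v z (z + 3 * u) = z + 3 * u"
  "zigzag_map n u v z (z + 3 * u + v) = z + 3 * u + v"
  using ndvd by (auto simp: zigzag_map_def cong_iff_dvd_diff dvd_diff_commute algebra_simps)

lemma zigzag_walk:
  assumes "pwalk n u v S x y p"
  shows "pwalk n u v S' (zigzag_map n u v z x) (zigzag_map n u v z y) p"
  using assms
proof (induction rule: pwalk.induct)
  case (cong x y)
  then show ?case by (intro pwalk.cong zigzag_map_cong)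
next
  case (straight x)
  let ?m = "zigzag_map n u v z"
  have *: ?case if "[x = x'] (mod n)" "pwalk n u v S' (?m x') (?m (x' + u)) True" for x'
    using that zigzag_map_cong[of x x'] zigzag_map_cong[of "x + u" "x' + u"]
    by (metis cong_add cong_refl cong_sym pwalk_cong)
  note b = zigzag_bypass(6)
  consider "[x = z + u] (mod n)" | "[x = z + u + v] (mod n)" | "[x = z + 2 * u] (mod n)"
    | "[x = z + 2 * u + v] (mod n)"
    | "\<not> [x = z + u] (mod n)" "\<not> [x = z + u + v] (mod n)" "\<not> [x = z + 2 * u] (mod n)"
      "\<not> [x = z + 2 * u + v] (mod n)" by blast
  then show ?case
  proof cases
    case 1
    have "z + u + u = z + 2 * u" by simp
    then show ?thesis using 1 b by (intro *[OF 1]) (simp only: zigzag_map_simps)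
  next
    case 2
    have "z + u + v + u = z + 2 * u + v" by simp
    then show ?thesis using pwalk.sym[OF b] by (intro *[OF 2]) (simp only: zigzag_map_simps)
  next
    case 3
    have "z + 2 * u + u = z + 3 * u" by simp
    then show ?thesis using pwalk.sym[OF b] by (intro *[OF 3]) (simp only: zigzag_map_simps)
  next
    case 4
    have "z + 2 * u + v + u = z + 3 * u + v" by simp
    then show ?thesis using b by (intro *[OF 4]) (simp only: zigzag_map_simps)
  next
    case 5
    \<comment> \<open>As \<open>z \<in> S\<close>, the \<open>u\<close>-edges at \<open>z\<close>
      and \<open>z + v\<close> are already switched, so no straight edge enters the collapsed
      vertices from there.\<close>
    have "\<not> [x + u = z + u] (mod n)" 
    proof
      assume "[x + u = z + u] (mod n)"
      then have "[x = z] (mod n)" by (simp add: cong_add_rcancel)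
      then show False using periodicD[OF per] straight zS by blast
    qed
    moreover have "\<not> [x + u = z + u + v] (mod n)" 
    proof
      assume "[x + u = z + u + v] (mod n)"
      then have "[x - v = z] (mod n)" by (simp add: cong_iff_dvd_diff algebra_simps)
      then show False using periodicD[OF per] straight zS by blast
    qed
    moreover have "\<not> [x + u = z + 2 * u] (mod n)" "\<not> [x + u = z + 2 * u + v] (mod n)" 
      using 5 by (auto simp: cong_iff_dvd_diff algebra_simps)
    ultimately have m: "?m x = x" "?m (x + u) = x + u" using 5 by (auto simp: zigzag_map_def)
    show ?thesis
    proof (cases "[x = z + u - v] (mod n)")
      case True
      \<comment> \<open>The only \<open>u\<close>-edge starting outside the four collapsed vertices
        that the new squares destroy. Its replacement has five edges, again an odd number.\<close>
      have "pwalk n u v S' (z + u - v) (z + 2 * u - v) True"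
        using pwalk.trans[OF pwalk.trans[OF pwalk.trans[OF pwalk.trans[OF
          pwalk.sym[OF zigzag_bypass(1)] zigzag_bypass(2)] zigzag_bypass(3)] 
          pwalk.sym[OF zigzag_bypass(4)]] zigzag_bypass(5)] by simp
      then have "pwalk n u v S' x (x + u) True"
        by (rule pwalk_cong) (use True in \<open>auto simp: cong_iff_dvd_diff algebra_simps dvd_diff_commute\<close>)
      then show ?thesis using m by simp
    next
      case False
      have "x \<notin> S'" "x - v \<notin> S'" using 5 False straight
        by (auto simp: S' cong_iff_dvd_diff algebra_simps)
      then show ?thesis using m by (simp add: pwalk.straight)
    qed
  qed
next
  case (cross x)
  let ?m = "zigzag_map n u v z"
  have no: "\<not> [x = x'] (mod n)" if "x' \<notin> S" "x' - u \<notin> S" for x'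
    using periodicD[OF per, of x x'] periodicD[OF per, of "x - u" "x' - u"] cross that
    by (metis cong_diff cong_refl)
  show ?case
  proof (cases "[x = z + u] (mod n)")
    case True
    have "[?m x = z + 3 * u] (mod n)" "[?m (x + v) = z + 3 * u + v] (mod n)"
      using zigzag_map_cong[OF True] zigzag_map_cong[OF cong_add[OF True cong_refl, of v]]
      by (simp_all only: zigzag_map_simps)
    then show ?thesis by (intro pwalk_cong[OF zigzag_bypass(6)]) (rule cong_sym, assumption)+
  next
    case False
    have e: "z + u + v - u = z + v" "z + 2 * u - u = z + u" "z + 2 * u + v - u = z + u + v"
      "z + u - v - u = z - v" "z + 2 * u - v - u = z + u - v" by simp_all
    have "\<not> [x = z + u + v] (mod n)" "\<not> [x = z + 2 * u] (mod n)" "\<not> [x = z + 2 * u + v] (mod n)"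
      "\<not> [x = z + u - v] (mod n)" "\<not> [x = z + 2 * u - v] (mod n)"
      by (rule no; simp only: e notin not_False_eq_True)+
    then have "?m x = x" "?m (x + v) = x + v"
      using False by (auto simp: zigzag_map_def cong_iff_dvd_diff algebra_simps)
    moreover have "x \<in> S' \<or> x - u \<in> S'" using cross zigzag_new by auto
    ultimately show ?thesis by (simp add: pwalk.cross)
  qed
next
  case (sym x y p)
  from sym.IH show ?case by (rule pwalk.sym)
next
  case (trans x y p z q)
  from trans.IH show ?case by (rule pwalk.trans)
qed

lemma zigzag_walk_fixed:
  assumes "pwalk n u v S x y p"
    and "\<And>w. w \<in> {x, y} \<Longrightarrow> \<not> [w = z + u] (mod n) \<and> \<not> [w = z + u + v] (mod n) \<and>
      \<not> [w = z + 2 * u] (mod n) \<and> \<not> [w = z + 2 * u + v] (mod n)"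
  shows "pwalk n u v S' x y p"
  using zigzag_walk[OF assms(1)] assms(2) by (simp add: zigzag_map_def)

text \<open>The collapse fixes \<open>z + u - v\<close>, so old walks to this vertex survive; the
  four collapsed vertices reach it along the inserted detour.\<close>

lemma zigzag_connected:
  assumes "walk_connected n u v S"
  shows "walk_connected n u v S'"
proof -
  let ?m = "zigzag_map n u v z"
  let ?t = "z + u - v"
  have "\<not> n dvd - u - 2 * v" using ndvd(9) dvd_minus_iff[of n "u + 2 * v"] by simp
  then have t: "?m ?t = ?t" using ndvd
    by (auto simp: zigzag_map_def cong_iff_dvd_diff algebra_simps dvd_diff_commute)
  have "\<exists>p. pwalk n u v S' x ?t p" for x
  proof -
    consider "[x = z + u] (mod n)" | "[x = z + u + v] (mod n)" | "[x = z + 2 * u] (mod n)"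
      | "[x = z + 2 * u + v] (mod n)" | "?m x = x" unfolding zigzag_map_def by argo
    then show ?thesis
    proof cases
      case 5
      then show ?thesis using assms zigzag_walk[of x ?t] t unfolding walk_connected_def by metis
    next
      case 1
      from pwalk.trans[OF pwalk.cong[OF this] zigzag_bypass(1)] show ?thesis by blast
    next
      case 2
      from pwalk.trans[OF pwalk.trans[OF pwalk.cong[OF this] pwalk.sym[OF zigzag_bypass(2)]]
        zigzag_bypass(1)] show ?thesis by blast
    next
      case 3
      from pwalk.trans[OF pwalk.trans[OF pwalk.trans[OF pwalk.trans[OF pwalk.cong[OF this]
        zigzag_bypass(4)] pwalk.sym[OF zigzag_bypass(3)]] pwalk.sym[OF zigzag_bypass(2)]]
        zigzag_bypass(1)] show ?thesis by blast
    next
      case 4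
      from pwalk.trans[OF pwalk.trans[OF pwalk.trans[OF pwalk.cong[OF this]
        pwalk.sym[OF zigzag_bypass(3)]] pwalk.sym[OF zigzag_bypass(2)]]
        zigzag_bypass(1)] show ?thesis by blast
    qed
  qed
  then show ?thesis by (rule walk_connectedI)
qed

end

section \<open>Connection by walks with the parity forgotten\<close>

definition joined :: "int \<Rightarrow> int \<Rightarrow> int \<Rightarrow> int set \<Rightarrow> int \<Rightarrow> int \<Rightarrow> bool" where
  "joined n u v S x y \<longleftrightarrow> (\<exists>p. pwalk n u v S x y p)"

lemma joinedI: "pwalk n u v S x y p \<Longrightarrow> joined n u v S x y"
  by (auto simp: joined_def)

lemma joined_cong: "[x = y] (mod n) \<Longrightarrow> joined n u v S x y"
  by (rule joinedI) (rule pwalk.cong)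

lemma joined_sym: "joined n u v S x y \<Longrightarrow> joined n u v S y x"
  unfolding joined_def using pwalk.sym by blast

lemma joined_trans [trans]:
  assumes "joined n u v S x y" "joined n u v S y z"
  shows "joined n u v S x z"
proof -
  obtain p q where "pwalk n u v S x y p" "pwalk n u v S y z q" using assms by (auto simp: joined_def)
  from pwalk.trans[OF this] show ?thesis by (rule joinedI)
qed

lemma joined_progression:
  assumes "\<And>i. i < t \<Longrightarrow> joined n u v S (x + int i * w) (x + int i * w + w)"
  shows "joined n u v S x (x + int t * w)"
  using assms
proof (induction t)
  case 0
  then show ?case by (simp add: joined_cong)
next
  case (Suc t)
  have "joined n u v S x (x + int t * w)" using Suc by simp
  also have "joined n u v S (x + int t * w) (x + int t * w + w)" using Suc.prems by simp
  finally show ?case by (simp add: algebra_simps)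
qed

section \<open>Staircases and zigzags\<close>

text \<open>The heights are \<open>0, 1, \<dots>, M - 1\<close>, followed by \<open>M - 2, M - 1, M - 2, \<dots>\<close>.\<close>

definition zigzag_row :: "nat \<Rightarrow> nat \<Rightarrow> int" where
  "zigzag_row M g = (if g < M then int g else int M - 1 - int ((g - M + 1) mod 2))"

definition corners :: "int \<Rightarrow> int \<Rightarrow> int \<Rightarrow> nat \<Rightarrow> nat \<Rightarrow> int set" where
  "corners n u v M N = {x. \<exists>g<N. [x = int g * u + zigzag_row M g * v] (mod n)}"

lemma periodic_corners: "periodic n (corners n u v M N)"
  unfolding periodic_def corners_def by (auto intro: cong_trans[OF cong_sym])

text \<open>For the first \<open>M\<close> squares height and column number agree. This symmetry
  lets results about one family of cycles be applied to the other; only a prolongation breaks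
  it.\<close>

lemma corners_staircase_commute: "corners n u v M M = corners n v u M M"
  unfolding corners_def zigzag_row_def by (auto simp: add.commute)

lemma cornersI: "g < N \<Longrightarrow> int g * u + zigzag_row M g * v \<in> corners n u v M N"
  by (auto simp: corners_def)

section \<open>Coordinates across and along the cycles of one jump\<close>

locale jumps =
  fixes n u v :: int
  assumes n_pos: "0 < n" and coprime_jumps: "gcd (gcd u v) n = 1"
begin

text \<open>The number of cycles formed by the \<open>v\<close>-edges, each of length
  \<open>len\<close>. The vertex \<open>i * u + j * v\<close> is position \<open>j\<close> on cycle
  \<open>i\<close>.\<close>

abbreviation lines :: int where "lines \<equiv> gcd v n"
abbreviation len :: int where "len \<equiv> n div gcd v n"

lemma lines_pos: "0 < lines" using n_pos by (simp add: gcd_pos_int)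

lemma n_eq: "n = len * lines" by simp

lemma len_pos: "0 < len"
  using n_pos lines_pos by (metis n_eq zero_less_mult_pos2)

text \<open>Modulo \<open>lines\<close> both \<open>v\<close> and \<open>n\<close> vanish and
  \<open>u\<close> is invertible, so the number of the \<open>v\<close>-cycle can be read
  off.\<close>

lemma line_index:
  assumes "[i * u + j * v = i' * u + j' * v] (mod n)"
  shows "[i = i'] (mod lines)"
proof -
  have "[i * u + j * v = i' * u + j' * v] (mod lines)"
    using assms by (rule cong_dvd_modulus) simp
  then have "lines dvd (i - i') * u + (j - j') * v"
    by (simp add: cong_iff_dvd_diff algebra_simps)
  then have "lines dvd (i - i') * u" by (metis dvd_add_left_iff dvd_mult gcd_dvd1)
  moreover have "coprime lines u"
    using coprime_jumps by (simp add: coprime_iff_gcd_eq_1 gcd.commute gcd.left_commute gcd.assoc)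
  ultimately show ?thesis by (simp add: cong_iff_dvd_diff coprime_dvd_mult_left_iff)
qed

text \<open>Passing through all \<open>v\<close>-cycles leads back to the first one, displaced by
  some \<open>e\<close> along it. The parity of this twist matters later.\<close>

lemma line_shift: "\<exists>e. [lines * u = e * v] (mod n)"
proof -
  obtain \<alpha> \<beta> where "\<alpha> * v + \<beta> * n = lines" by (metis bezout_int)
  then have "lines * u = (\<alpha> * v + \<beta> * n) * u" by simp
  then have "lines * u = (\<alpha> * u) * v + n * (\<beta> * u)" by (simp add: algebra_simps)
  then show ?thesis by (metis cong_iff_lin cong_sym)
qed

lemma line_rep: "\<exists>i j. 0 \<le> i \<and> i < lines \<and> [x = i * u + j * v] (mod n)"
proof -
  obtain \<alpha> \<beta> where 1: "\<alpha> * gcd u v + \<beta> * n = 1" using bezout_int coprime_jumps by metis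
  obtain \<gamma> \<delta> where 2: "\<gamma> * u + \<delta> * v = gcd u v" by (metis bezout_int)
  obtain e where e: "[lines * u = e * v] (mod n)" using line_shift by blast
  let ?s = "x * \<alpha> * \<gamma>"
  have "x = x * (\<alpha> * (\<gamma> * u + \<delta> * v) + \<beta> * n)" using 1 2 by simp
  also have "\<dots> = ?s * u + (x * \<alpha> * \<delta>) * v + n * (x * \<beta>)" by (simp add: algebra_simps)
  finally have "[x = ?s * u + (x * \<alpha> * \<delta>) * v] (mod n)" by (metis cong_iff_lin cong_sym)
  moreover have "[?s * u = (?s mod lines) * u + (?s div lines) * (e * v)] (mod n)"
  proof -
    have "?s * u = (?s mod lines) * u + (?s div lines) * (lines * u)"
      by (metis (no_types, lifting) add.commute distrib_right mult.assoc mult_div_mod_eq mult.commute)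
    then show ?thesis using cong_add[OF cong_refl cong_scalar_left[OF e]] by metis
  qed
  ultimately have "[x = (?s mod lines) * u + (?s div lines) * (e * v) + (x * \<alpha> * \<delta>) * v] (mod n)"
    by (meson cong_add cong_refl cong_trans)
  then have "[x = (?s mod lines) * u + ((?s div lines) * e + x * \<alpha> * \<delta>) * v] (mod n)"
    by (simp add: algebra_simps)
  then show ?thesis using lines_pos by (metis pos_mod_bound pos_mod_sign)
qed

lemma len_dvd: "n dvd j * v \<longleftrightarrow> len dvd j"
proof -
  have "coprime len (v div lines)"
    using n_pos by (metis div_gcd_coprime coprime_commute less_irrefl)
  moreover have "n dvd j * v \<longleftrightarrow> len * lines dvd (j * (v div lines)) * lines"
    by (metis dvd_div_mult_self gcd_dvd1 gcd_dvd2 mult.assoc)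
  moreover have "len * lines dvd (j * (v div lines)) * lines \<longleftrightarrow> len dvd j * (v div lines)"
    by (subst dvd_mult_cancel_right) (use lines_pos in auto)
  ultimately show ?thesis by (metis coprime_dvd_mult_left_iff)
qed

lemma index_unique:
  assumes "[i * u + j * v = i' * u + j' * v] (mod n)" "0 \<le> i" "i < lines" "0 \<le> i'" "i' < lines"
  shows "i = i'"
  using line_index[OF assms(1)] assms(2-5) by (simp add: cong_def)

text \<open>Up to \<open>N = lines\<close> each line carries at most one square, so the line
  determines which square is meant.\<close>

lemma mem_corners:
  assumes "0 \<le> i" "i < lines" "int N \<le> lines"
  shows "i * u + j * v \<in> corners n u v M N \<longleftrightarrow> i < int N \<and> n dvd (j - zigzag_row M (nat i)) * v"
proof
  assume "i * u + j * v \<in> corners n u v M N"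
  then obtain g where g: "g < N" "[i * u + j * v = int g * u + zigzag_row M g * v] (mod n)"
    by (auto simp: corners_def)
  then have "i = int g" using index_unique assms by force
  then show "i < int N \<and> n dvd (j - zigzag_row M (nat i)) * v"
    using g by (auto simp: cong_iff_dvd_diff algebra_simps)
next
  assume "i < int N \<and> n dvd (j - zigzag_row M (nat i)) * v"
  then show "i * u + j * v \<in> corners n u v M N"
    unfolding corners_def using assms(1)
    by (auto intro!: exI[of _ "nat i"] simp: cong_iff_dvd_diff algebra_simps)
qed

lemma not_mem_corners:
  assumes "int N \<le> i" "i < lines"
  shows "i * u + j * v \<notin> corners n u v M N"
  using mem_corners[of i N j M] assms by auto

end

section \<open>Prolonging a staircase by zigzags\<close>

context jumps
begin

text \<open>\<open>z\<close> is the last square. As \<open>N - M\<close> is even it has the top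
  height \<open>M - 1\<close>, so the next two heights are \<open>M - 2\<close> and
  \<open>M - 1\<close>, exactly the squares of the zigzag exchange at \<open>z\<close>.\<close>

lemma corners_Suc_Suc:
  assumes "1 \<le> M" "M \<le> N" "even (N - M)"
  defines "z \<equiv> (int N - 1) * u + (int M - 1) * v"
  shows "corners n u v M (N + 2) =
      corners n u v M N \<union> {x. [x = z + u - v] (mod n)} \<union> {x. [x = z + 2 * u] (mod n)}"
proof -
  have "zigzag_row M N = int M - 2"
    using assms(2,3) by (simp add: zigzag_row_def) presburger
  moreover have "zigzag_row M (Suc N) = int M - 1"
    using assms(2,3) by (simp add: zigzag_row_def Suc_diff_le)
  ultimately have "int N * u + zigzag_row M N * v = z + u - v" "int (Suc N) * u + zigzag_row M (Suc N) * v = z + 2 * u"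
    by (simp_all only: z_def) (simp_all add: algebra_simps)
  then show ?thesis unfolding corners_def by (auto simp: less_Suc_eq)
qed

text \<open>Lines \<open>N\<close> and \<open>N + 1\<close> carry no squares yet and do not wrap
  around, which supplies the non-membership conditions. The four collapsed vertices lie on these two
  lines, so walks with both ends elsewhere keep their ends and parity.\<close>

lemma zigzag_stage:
  assumes M: "1 \<le> M" "M \<le> N" "even (N - M)" and l: "int N + 2 \<le> lines" and v2: "\<not> n dvd 2 * v"
  shows "walk_connected n u v (corners n u v M N) \<Longrightarrow> walk_connected n u v (corners n u v M (N + 2))"
    and "pwalk n u v (corners n u v M N) x y p \<Longrightarrow>
      (\<And>w i j. w \<in> {x, y} \<Longrightarrow> i \<in> {int N, int N + 1} \<Longrightarrow> \<not> [w = i * u + j * v] (mod n)) \<Longrightarrow>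
      pwalk n u v (corners n u v M (N + 2)) x y p"
proof -
  define z where "z = (int N - 1) * u + (int M - 1) * v"
  let ?S = "corners n u v M N"
  let ?S' = "?S \<union> {x. [x = z + u - v] (mod n)} \<union> {x. [x = z + 2 * u] (mod n)}"
  have S': "corners n u v M (N + 2) = ?S'" using corners_Suc_Suc[OF M] by (simp add: z_def)
  have lN: "int N \<le> lines" using l by simp
  have pos: "1 \<le> N" using M by simp
  have z1: "zigzag_row M (N - 1) = int M - 1"
    using M by (auto simp: zigzag_row_def Suc_diff_le)
  have z: "z \<in> ?S" using cornersI[of "N - 1" N u M v n] z1 pos by (simp add: z_def of_nat_diff)
  have "\<not> n dvd v" using v2 by (meson dvd_mult)
  have off: "\<not> n dvd i * u + j * v" if "i = 1 \<or> i = 2" for i j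
  proof
    assume "n dvd i * u + j * v"
    then have "[i * u + j * v = 0 * u + 0 * v] (mod n)" by (simp add: cong_iff_dvd_diff)
    then have "i = 0" by (rule index_unique) (use that l pos n_pos in auto)
    then show False using that by simp
  qed
  have off': "\<not> n dvd u" "\<not> n dvd 2 * u" "\<not> n dvd u - v" "\<not> n dvd u + v"
      "\<not> n dvd 2 * u - v" "\<not> n dvd 2 * u + v" "\<not> n dvd u + 2 * v"
    using off[of 1 0] off[of 2 0] off[of 1 "-1"] off[of 1 1] off[of 2 "-1"] off[of 2 1] off[of 1 2]
    by simp_all
  have same: "z + j * v \<notin> ?S" if "\<not> n dvd j * v" for j
  proof -
    have eq: "z + j * v = (int N - 1) * u + (int M - 1 + j) * v" by (simp add: z_def algebra_simps)
    have "z + j * v \<in> ?S \<longleftrightarrow>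
        int N - 1 < int N \<and> n dvd ((int M - 1 + j) - zigzag_row M (nat (int N - 1))) * v"
      unfolding eq by (rule mem_corners) (use l pos in auto)
    moreover have "nat (int N - 1) = N - 1" by simp
    ultimately show ?thesis using that z1 by simp
  qed
  have new: "z + i * u + j * v \<notin> ?S" if "i = 1 \<or> i = 2" for i j
  proof -
    have "z + i * u + j * v = (int N - 1 + i) * u + (int M - 1 + j) * v" by (simp add: z_def algebra_simps)
    then show ?thesis using not_mem_corners[of N "int N - 1 + i" "int M - 1 + j" M] that l by auto
  qed
  have new': "z - v \<notin> ?S" "z + v \<notin> ?S" "z + u \<notin> ?S" "z + u + v \<notin> ?S" "z + u - v \<notin> ?S"
      "z + 2 * u \<notin> ?S" "z + 2 * u + v \<notin> ?S" "z + 2 * u - v \<notin> ?S"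
    using same[of "-1"] same[of 1] new[of 1 0] new[of 1 1] new[of 1 "-1"] new[of 2 0] new[of 2 1] new[of 2 "-1"]
      \<open>\<not> n dvd v\<close> by simp_all
  note step = periodic_corners z refl new' off'(1) \<open>\<not> n dvd v\<close> off'(2) v2 off'(3-7)
  show "walk_connected n u v (corners n u v M (N + 2))" if "walk_connected n u v ?S"
    unfolding S' using that by (rule zigzag_connected[OF step])
  assume w: "pwalk n u v ?S x y p"
    and *: "\<And>w i j. w \<in> {x, y} \<Longrightarrow> i \<in> {int N, int N + 1} \<Longrightarrow> \<not> [w = i * u + j * v] (mod n)"
  have e: "z + u = int N * u + (int M - 1) * v" "z + u + v = int N * u + int M * v"
    "z + 2 * u = (int N + 1) * u + (int M - 1) * v" "z + 2 * u + v = (int N + 1) * u + int M * v"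
    by (simp_all add: z_def algebra_simps)
  show "pwalk n u v (corners n u v M (N + 2)) x y p"
    unfolding S'
  proof (rule zigzag_walk_fixed[OF step w])
    fix w assume w: "w \<in> {x, y}"
    have "\<not> [w = z + u] (mod n)" unfolding e(1) by (rule *[OF w]) simp
    moreover have "\<not> [w = z + u + v] (mod n)" unfolding e(2) by (rule *[OF w]) simp
    moreover have "\<not> [w = z + 2 * u] (mod n)" unfolding e(3) by (rule *[OF w]) simp
    moreover have "\<not> [w = z + 2 * u + v] (mod n)" unfolding e(4) by (rule *[OF w]) simp
    ultimately show "\<not> [w = z + u] (mod n) \<and> \<not> [w = z + u + v] (mod n) \<and>
      \<not> [w = z + 2 * u] (mod n) \<and> \<not> [w = z + 2 * u + v] (mod n)" by blast
  qed
qed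

lemma zigzag_family_connected:
  assumes "1 \<le> M" "int M + 2 * int h \<le> lines" "\<not> n dvd 2 * v"
    and "walk_connected n u v (corners n u v M M)"
  shows "walk_connected n u v (corners n u v M (M + 2 * h))"
  using assms(2)
proof (induction h)
  case (Suc h)
  then show ?case using zigzag_stage(1)[of M "M + 2 * h"] assms(1,3) by simp
qed (use assms(4) in simp)

lemma zigzag_family_walk:
  assumes "1 \<le> M" "int M + 2 * int h \<le> lines" "\<not> n dvd 2 * v"
    and "pwalk n u v (corners n u v M M) x y p"
    and "\<And>w i j. w \<in> {x, y} \<Longrightarrow> int M \<le> i \<Longrightarrow> i < int M + 2 * int h \<Longrightarrow> \<not> [w = i * u + j * v] (mod n)"
  shows "pwalk n u v (corners n u v M (M + 2 * h)) x y p"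
  using assms(2,5)
proof (induction h)
  case (Suc h)
  have "pwalk n u v (corners n u v M (M + 2 * h)) x y p" using Suc by simp
  moreover have "\<not> [w = i * u + j * v] (mod n)"
    if "w \<in> {x, y}" "i \<in> {int (M + 2 * h), int (M + 2 * h) + 1}" for w i j
    using Suc.prems(2)[OF that(1), of i j] that(2) by auto
  ultimately show ?case
    using zigzag_stage(2)[of M "M + 2 * h" x y p] assms(1,3) Suc.prems(1) by simp
qed (use assms(4) in simp)

section \<open>Merging the cycles of one jump\<close>

lemma joined_round:
  assumes "\<And>j. \<not> n dvd j * v \<Longrightarrow> joined n v u S (z + j * v) (z + j * v + v)"
  shows "joined n v u S z (z + v)"
proof -
  \<comment> \<open>The other way round the \<open>v\<close>-cycle: its remaining
    \<open>len - 1\<close> edges lead from \<open>z + v\<close> back to \<open>z\<close>.\<close>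
  have "joined n v u S (z + v) (z + v + int (nat (len - 1)) * v)"
  proof (rule joined_progression)
    fix i assume "i < nat (len - 1)"
    then have "\<not> len dvd int i + 1" using len_pos zdvd_not_zless[of "int i + 1" len] by simp
    then have "joined n v u S (z + (int i + 1) * v) (z + (int i + 1) * v + v)"
      using assms len_dvd by blast
    then show "joined n v u S (z + v + int i * v) (z + v + int i * v + v)"
      by (simp add: algebra_simps)
  qed
  moreover have "z + v + int (nat (len - 1)) * v = z + len * v"
    using len_pos by (simp add: algebra_simps)
  moreover have "[z + len * v = z] (mod n)"
    using len_dvd[of len] by (simp add: cong_iff_dvd_diff)
  ultimately have "joined n v u S (z + v) z" using joined_cong joined_trans by metis
  then show ?thesis by (rule joined_sym)
qed

lemma joined_line:
  assumes "\<And>j. joined n v u S (z + j * v) (z + j * v + v)"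
  shows "joined n v u S z (z + j * v)"
proof (cases "0 \<le> j")
  case True
  then show ?thesis using joined_progression[of "nat j" n v u S z v] assms by simp
next
  case False
  have "joined n v u S (z + j * v) (z + j * v + int (nat (- j)) * v)"
  proof (rule joined_progression)
    fix i show "joined n v u S (z + j * v + int i * v) (z + j * v + int i * v + v)"
      using assms[of "j + int i"] by (simp add: algebra_simps)
  qed
  then show ?thesis using False joined_sym by simp
qed

lemma connected_lines:
  assumes line: "\<And>g j. int g < lines \<Longrightarrow> joined n v u S (int g * u + j * v) (int g * u + j * v + v)"
    and link: "\<And>g. int g + 1 < lines \<Longrightarrow> \<exists>j. joined n v u S (int g * u + j * v) (int g * u + j * v + u)"
  shows "walk_connected n v u S"
proof (rule walk_connectedI)
  have l: "joined n v u S (int g * u + j * v) (int g * u + j' * v)" if "int g < lines" for g j j'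
    using joined_line[of S "int g * u" j] joined_line[of S "int g * u" j'] line[OF that]
      joined_sym joined_trans by metis
  have z: "joined n v u S (int g * u + j * v) 0" if "int g < lines" for g j
    using that
  proof (induction g arbitrary: j)
    case 0
    then show ?case using l[of 0 j 0] by simp
  next
    case (Suc g)
    obtain j' where "joined n v u S (int g * u + j' * v) (int g * u + j' * v + u)"
      using link[of g] Suc.prems by auto
    then have "joined n v u S (int (Suc g) * u + j' * v) (int g * u + j' * v)"
      using joined_sym by (simp add: algebra_simps)
    then have "joined n v u S (int (Suc g) * u + j' * v) 0"
      by (rule joined_trans) (use Suc in simp)
    then show ?case using l[OF Suc.prems, of j j'] joined_trans by metis
  qed
  fix x
  obtain i j where "0 \<le> i" "i < lines" "[x = i * u + j * v] (mod n)" using line_rep by blast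
  then have "joined n v u S x 0" using z[of "nat i" j] joined_trans[OF joined_cong] by auto
  then show "\<exists>p. pwalk n v u S x 0 p" by (simp add: joined_def)
qed

lemma path_connected:
  assumes N: "int N + 1 = lines"
  shows "walk_connected n v u (corners n u v M N)"
proof -
  let ?S = "corners n u v M N"
  have cross: "joined n v u ?S z (z + u)" "joined n v u ?S (z + v) (z + v + u)" if "z \<in> ?S" for z
    using pwalk.cross[of z ?S v n u] pwalk.cross[of "z + v" ?S v n u] that by (auto intro: joinedI)
  have uniq: "n dvd j * v" if "z + j * v \<in> ?S" "z \<in> ?S" "z = int g * u + k * v" "int g < lines" for z j g k
  proof -
    have "z + j * v = int g * u + (k + j) * v" using that by (simp add: algebra_simps)
    with that(1,2) have "int g * u + (k + j) * v \<in> ?S" "int g * u + k * v \<in> ?S"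
      by (simp_all only: that(3))
    then have "n dvd (k + j - zigzag_row M g) * v" "n dvd (k - zigzag_row M g) * v"
      using that(4) mem_corners[of "int g" N k M] mem_corners[of "int g" N "k + j" M] N by auto
    from dvd_diff[OF this] show ?thesis by (simp add: algebra_simps)
  qed
  have step: "joined n v u ?S (int g * u + j * v) (int g * u + j * v + v)"
    if "int g < lines" "int g * u + j * v \<notin> ?S" for g j
    using that
  proof (induction g arbitrary: j)
    case 0
    have "j * v - u \<notin> ?S"
    proof
      assume "j * v - u \<in> ?S"
      then obtain g where g: "g < N" "[j * v - u = int g * u + zigzag_row M g * v] (mod n)" by (auto simp: corners_def)
      then have "[(-1) * u + j * v = int g * u + zigzag_row M g * v] (mod n)" by (simp add: algebra_simps)
      then have "[-1 = int g] (mod lines)" by (rule line_index)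
      then have "lines dvd int g + 1" by (simp add: cong_iff_dvd_diff dvd_diff_commute[of _ "-1"])
      then show False using zdvd_not_zless[of "int g + 1" lines] N g(1) by simp
    qed
    then show ?case using 0 by (auto intro!: joinedI pwalk.straight)
  next
    case (Suc g)
    let ?x = "int (Suc g) * u + j * v"
    let ?z = "int g * u + j * v"
    have e: "?x - u = ?z" "?z + u = ?x" "?z + v + u = ?x + v" by (simp_all add: algebra_simps)
    show ?case
    proof (cases "?z \<in> ?S")
      case False
      then show ?thesis using Suc.prems(2) by (intro joinedI[OF pwalk.straight]) (simp_all only: e not_False_eq_True)
    next
      case True
      have "joined n v u ?S ?z (?z + v)"
      proof (rule joined_round)
        fix k assume "\<not> n dvd k * v"
        then have "?z + k * v \<notin> ?S" using uniq[of ?z k g j] True Suc.prems by auto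
        moreover have eq: "?z + k * v = int g * u + (j + k) * v" by (simp add: algebra_simps)
        ultimately show "joined n v u ?S (?z + k * v) (?z + k * v + v)"
          unfolding eq using Suc.IH[of "j + k"] Suc.prems by simp
      qed
      moreover have "joined n v u ?S ?z ?x" "joined n v u ?S (?z + v) (?x + v)"
        using cross[OF True] by (simp_all only: e)
      ultimately show ?thesis using joined_sym joined_trans by metis
    qed
  qed
  show ?thesis
  proof (rule connected_lines)
    fix g j assume g: "int g < lines"
    show "joined n v u ?S (int g * u + j * v) (int g * u + j * v + v)" 
    proof (cases "int g * u + j * v \<in> ?S")
      case True
      show ?thesis
      proof (rule joined_round)
        fix k assume "\<not> n dvd k * v"
        then have "int g * u + j * v + k * v \<notin> ?S" using uniq[OF _ True] g by auto
        moreover have eq: "int g * u + j * v + k * v = int g * u + (j + k) * v" by (simp add: algebra_simps)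
        ultimately show "joined n v u ?S (int g * u + j * v + k * v) (int g * u + j * v + k * v + v)"
          unfolding eq using step[of g "j + k"] g by simp
      qed
    qed (use step g in auto)
  next
    fix g assume "int g + 1 < lines"
    then show "\<exists>j. joined n v u ?S (int g * u + j * v) (int g * u + j * v + u)"
      using cross(1)[OF cornersI[of g N]] N by auto
  qed
qed

text \<open>
  Each \<open>v\<close>-cycle is cut into two arcs by the squares on its two sides. Following the links, one
  traverses an arc of every cycle alternately upwards and downwards; since the number \<open>N\<close> of
  cycles is odd, one returns to the first cycle on its other arc. The numbers \<open>e g\<close> are the
  differences of consecutive heights.
\<close>

lemma cyclic_odd_and_connected:
  assumes N: "int N = lines" and "odd N" "even n" "even u" "odd v"
  shows "\<And>z. z \<in> corners n u v M N \<Longrightarrow> pwalk n v u (corners n u v M N) z (z + u + v) True"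
    and "walk_connected n v u (corners n u v M N)"
proof -
  let ?S = "corners n u v M N"
  let ?W = "pwalk n v u ?S"
  have N0: "0 < N" using \<open>odd N\<close> by (auto intro: Nat.gr0I)
  define z where "z g = int (g mod N) * u + zigzag_row M (g mod N) * v" for g
  have zS: "z g \<in> ?S" for g unfolding z_def by (rule cornersI) (use N0 in simp)
  have Sz: "\<exists>g. [x = z g] (mod n)" if "x \<in> ?S" for x
  proof -
    obtain g where g: "g < N" "[x = int g * u + zigzag_row M g * v] (mod n)" using \<open>x \<in> ?S\<close> by (auto simp: corners_def)
    then show ?thesis by (intro exI[of _ g]) (simp add: z_def)
  qed
  have uniq: "n dvd j * v" if "z g + j * v \<in> ?S" for g j
  proof -
    have "z g + j * v = int (g mod N) * u + (zigzag_row M (g mod N) + j) * v" by (simp add: z_def algebra_simps)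
    moreover have "int (g mod N) < lines" using N0 by (simp flip: N)
    ultimately show ?thesis using that mem_corners[of "int (g mod N)" N "zigzag_row M (g mod N) + j" M] N by simp
  qed
  have "\<exists>e. [z (Suc g) = z g + u + e * v] (mod n)" for g
  proof (cases "Suc (g mod N) = N")
    case True
    obtain e where "[lines * u = e * v] (mod n)" using line_shift by blast
    then have "[int (Suc (g mod N)) * u = e * v] (mod n)" using N True by simp
    then have "n dvd (int (g mod N) * u + u) - e * v" by (simp add: cong_iff_dvd_diff algebra_simps)
    moreover have "z (Suc g) = zigzag_row M 0 * v" using True by (simp add: z_def mod_Suc)
    ultimately show ?thesis
      by (intro exI[of _ "zigzag_row M 0 - zigzag_row M (g mod N) - e"])
        (simp add: z_def cong_iff_dvd_diff algebra_simps dvd_diff_commute)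
  next
    case False
    then show ?thesis
      by (intro exI[of _ "zigzag_row M (Suc (g mod N)) - zigzag_row M (g mod N)"]) (simp add: z_def mod_Suc algebra_simps)
  qed
  then obtain e where e: "\<And>g. [z (Suc g) = z g + u + e g * v] (mod n)" by metis
  have "even len" using \<open>even n\<close> \<open>odd N\<close> N n_eq by (metis even_mult_iff even_of_nat)
  have parity: "odd (nat (k mod len)) = odd k" for k
    using \<open>even len\<close> len_pos by (simp add: even_nat_iff dvd_mod_iff)
  \<comment> \<open>The arc from the far corner of one square forward to the corner of the next.
    Reducing its length modulo \<open>len\<close> keeps the parity because \<open>len\<close> is
    even.\<close>
  have up: "?W (z g + u + v) (z (Suc g)) (odd (e g - 1))" for g
  proof -
    let ?t = "nat ((e g - 1) mod len)"
    have "?W (z g + u + v) (z g + u + v + int ?t * v) (odd ?t)"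
    proof (rule pwalk_run)
      fix i assume "i < ?t"
      then have i: "int i < (e g - 1) mod len" by simp
      then have "int i + 1 < len" using pos_mod_bound[OF len_pos, of "e g - 1"] by linarith
      then have "\<not> len dvd int i + 1" by (simp add: zdvd_not_zless)
      then have "z g + (int i + 1) * v \<notin> ?S" using uniq len_dvd by blast
      moreover have "z g + u + v + int i * v \<notin> ?S"
      proof
        assume "z g + u + v + int i * v \<in> ?S"
        moreover have "[z g + u + v + int i * v = z (Suc g) + (int i + 1 - e g) * v] (mod n)"
          using e[of g] by (simp add: cong_iff_dvd_diff algebra_simps dvd_diff_commute)
        ultimately have "z (Suc g) + (int i + 1 - e g) * v \<in> ?S" using periodicD[OF periodic_corners] by blast
        then have "len dvd int i - (e g - 1)" using uniq len_dvd by (metis diff_diff_eq2 add.commute)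
        then have "(e g - 1) mod len = int i mod len" by (simp add: mod_eq_dvd_iff dvd_diff_commute)
        then show False using i \<open>int i + 1 < len\<close> by simp
      qed
      ultimately show "z g + u + v + int i * v \<notin> ?S \<and> z g + u + v + int i * v - u \<notin> ?S"
        by (simp add: algebra_simps)
    qed
    then have "?W (z g + u + v) (z g + u + v + ((e g - 1) mod len) * v) (odd (e g - 1))"
      using len_pos parity by simp
    moreover have "[z g + u + v + ((e g - 1) mod len) * v = z (Suc g)] (mod n)"
    proof -
      have "n dvd ((e g - 1) mod len - (e g - 1)) * v" by (simp add: len_dvd mod_eq_dvd_iff[symmetric])
      then have "[z g + u + v + ((e g - 1) mod len) * v = z g + u + e g * v] (mod n)"
        by (simp add: cong_iff_dvd_diff algebra_simps)
      then show ?thesis using e[of g] cong_trans cong_sym by blast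
    qed
    ultimately show ?thesis using pwalk_cong cong_refl by blast
  qed
  have down: "?W (z g + u) (z (Suc g) + v) (odd (e g - 1))" for g
  proof -
    let ?t = "nat ((- e g - 1) mod len)"
    have "?W (z (Suc g) + v) (z (Suc g) + v + int ?t * v) (odd ?t)"
    proof (rule pwalk_run)
      fix i assume "i < ?t"
      then have i: "int i < (- e g - 1) mod len" by simp
      then have "int i + 1 < len" using pos_mod_bound[OF len_pos, of "- e g - 1"] by linarith
      then have "\<not> len dvd int i + 1" by (simp add: zdvd_not_zless)
      then have "z (Suc g) + (int i + 1) * v \<notin> ?S" using uniq len_dvd by blast
      moreover have "z (Suc g) + v + int i * v - u \<notin> ?S"
      proof
        assume "z (Suc g) + v + int i * v - u \<in> ?S"
        moreover have "[z (Suc g) + v + int i * v - u = z g + (int i + 1 + e g) * v] (mod n)"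
          using e[of g] by (simp add: cong_iff_dvd_diff algebra_simps)
        ultimately have "z g + (int i + 1 + e g) * v \<in> ?S" using periodicD[OF periodic_corners] by blast
        then have "len dvd int i + 1 + e g" using uniq len_dvd by blast
        then have "len dvd int i - (- e g - 1)" by (simp add: algebra_simps)
        then have "(- e g - 1) mod len = int i mod len" by (metis mod_eq_dvd_iff)
        then show False using i \<open>int i + 1 < len\<close> by simp
      qed
      ultimately show "z (Suc g) + v + int i * v \<notin> ?S \<and> z (Suc g) + v + int i * v - u \<notin> ?S"
        by (simp add: algebra_simps)
    qed
    then have "?W (z (Suc g) + v) (z (Suc g) + v + ((- e g - 1) mod len) * v) (odd (e g - 1))"
      using len_pos parity[of "- e g - 1"] by simp
    moreover have "[z (Suc g) + v + ((- e g - 1) mod len) * v = z g + u] (mod n)"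
    proof -
      have "n dvd ((- e g - 1) mod len - (- e g - 1)) * v" by (simp add: len_dvd mod_eq_dvd_iff[symmetric])
      moreover have "n dvd z (Suc g) - (z g + u + e g * v)" using e[of g] by (simp add: cong_iff_dvd_diff)
      ultimately have "n dvd ((- e g - 1) mod len - (- e g - 1)) * v + (z (Suc g) - (z g + u + e g * v))"
        by (rule dvd_add)
      then show ?thesis by (simp add: cong_iff_dvd_diff algebra_simps)
    qed
    ultimately show ?thesis using pwalk_cong cong_refl pwalk.sym by blast
  qed
  have cr: "?W (z g) (z g + u) True" "?W (z g + v) (z g + u + v) True" for g
    using pwalk.cross[of "z g" ?S v n u] pwalk.cross[of "z g + v" ?S v n u] zS[of g]
    by (simp_all add: algebra_simps)
  have two: "?W (z g + u + v) (z (Suc (Suc g)) + u + v) (odd (e g + e (Suc g)))" for g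
    using pwalk.trans[OF pwalk.trans[OF pwalk.trans[OF up[of g] cr(1)] down[of "Suc g"]] cr(2)]
    by simp
  have chain: "?W (z g + u + v) (z (g + 2 * k) + u + v) (odd (\<Sum>i<2 * k. e (g + i)))" for g k
  proof (induction k)
    case 0
    then show ?case by (simp add: pwalk_refl)
  next
    case (Suc k)
    have eq: "(odd (\<Sum>i<2 * k. e (g + i)) \<noteq> odd (e (g + 2 * k) + e (Suc (g + 2 * k)))) =
        odd (\<Sum>i<2 * Suc k. e (g + i))" by (simp add: add.assoc) blast
    have "g + 2 * Suc k = Suc (Suc (g + 2 * k))" by simp
    then show ?case using pwalk.trans[OF Suc two[of "g + 2 * k"]] unfolding eq by (simp only:)
  qed
  have tot: "[z (g + k) = z g + int k * u + (\<Sum>i<k. e (g + i)) * v] (mod n)" for g k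
  proof (induction k)
    case (Suc k)
    then have "[z (g + k) + u + e (g + k) * v =
        z g + int k * u + (\<Sum>i<k. e (g + i)) * v + u + e (g + k) * v] (mod n)"
      by (intro cong_add cong_refl)
    then have "[z (Suc (g + k)) = z g + int k * u + (\<Sum>i<k. e (g + i)) * v + u + e (g + k) * v] (mod n)"
      using e[of "g + k"] cong_trans by blast
    then show ?case by (simp add: algebra_simps)
  qed simp
  \<comment> \<open>One full round returns to the same corner, so \<open>N * u\<close> plus the
    total shift times \<open>v\<close> vanishes modulo \<open>n\<close>; here \<open>n\<close> and
    \<open>u\<close> are even and \<open>v\<close> is odd.\<close>
  have sum: "even (\<Sum>i<N. e (g + i))" for g
  proof -
    have "z (g + N) = z g" by (simp add: z_def)
    then have "n dvd int N * u + (\<Sum>i<N. e (g + i)) * v"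
      using tot[of g N] by (simp add: cong_iff_dvd_diff dvd_diff_commute algebra_simps)
        (metis add.commute dvd_minus_iff minus_add_distrib uminus_add_conv_diff)
    then have "even (int N * u + (\<Sum>i<N. e (g + i)) * v)" using \<open>even n\<close> dvd_trans by blast
    then show ?thesis using \<open>even u\<close> \<open>odd v\<close> by simp
  qed
  \<comment> \<open>Parity count: \<open>N - 1\<close> cycles passed in pairs contribute the parity
    of their shifts, the closing arc that of its shift minus 1. The total shift is even, so the walk
    is odd.\<close>
  have odd_z: "?W (z g) (z g + u + v) True" for g
  proof -
    obtain k where k: "N = 2 * k + 1" using \<open>odd N\<close> by (auto elim: oddE)
    have "?W (z g + u + v) (z (Suc (g + 2 * k))) (odd (\<Sum>i<2 * k. e (g + i)) \<noteq> odd (e (g + 2 * k) - 1))"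
      by (rule pwalk.trans[OF chain up])
    moreover have "z (Suc (g + 2 * k)) = z g"
    proof -
      have "Suc (g + 2 * k) = g + N" using k by simp
      then show ?thesis by (simp only: z_def mod_add_self2)
    qed
    moreover have "odd (\<Sum>i<2 * k. e (g + i)) \<noteq> odd (e (g + 2 * k) - 1)"
      using sum[of g] k by simp
    ultimately show ?thesis by (simp add: pwalk.sym)
  qed
  show odd_S: "?W x (x + u + v) True" if "x \<in> ?S" for x
  proof -
    obtain g where "[x = z g] (mod n)" using Sz[OF \<open>x \<in> ?S\<close>] by blast
    then show ?thesis using pwalk_cong[OF odd_z[of g]] cong_sym cong_add[OF cong_add] cong_refl by meson
  qed
  have cross: "joined n v u ?S x (x + u)" "joined n v u ?S (x + v) (x + u + v)" if "x \<in> ?S" for x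
    using pwalk.cross[of x ?S v n u] pwalk.cross[of "x + v" ?S v n u] that
    by (auto intro!: joinedI simp: algebra_simps)
  \<comment> \<open>Each \<open>v\<close>-edge removed by a square is bridged by the walk between
    opposite corners and one crossing edge.\<close>
  have square: "joined n v u ?S x (x + v)" "joined n v u ?S (x + u) (x + u + v)" if "x \<in> ?S" for x
    using joinedI[OF odd_S[OF that]] cross[OF that] joined_sym joined_trans by metis+
  have edge: "joined n v u ?S x (x + v)" for x
  proof -
    consider "x \<in> ?S" | "x - u \<in> ?S" | "x \<notin> ?S" "x - u \<notin> ?S" by blast
    then show ?thesis
    proof cases
      case 1
      then show ?thesis by (rule square)
    next
      case 2
      from square(2)[OF this] show ?thesis by simp
    next
      case 3
      then show ?thesis by (intro joinedI[OF pwalk.straight])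
    qed
  qed
  show "walk_connected n v u ?S"
  proof (rule connected_lines)
    fix g assume "int g + 1 < lines"
    then show "\<exists>j. joined n v u ?S (int g * u + j * v) (int g * u + j * v + u)"
      using cross(1)[OF cornersI[of g N]] N by auto
  qed (rule edge)
qed

end

section \<open>Switched Hamilton cycles of a circulant graph\<close>

definition switched :: "int \<Rightarrow> int \<Rightarrow> int \<Rightarrow> int set \<Rightarrow> nat set set" where
  "switched n u v S =
     {{nat (x mod n), nat ((x + u) mod n)} | x. x \<notin> S \<and> x - v \<notin> S} \<union>
     {{nat (x mod n), nat ((x + v) mod n)} | x. x \<in> S \<or> x - u \<in> S}"

lemma nat_mod_eq_iff: "0 < n \<Longrightarrow> nat (x mod n) = nat (y mod n) \<longleftrightarrow> [x = y] (mod n)" for n :: int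
  by (simp add: cong_def eq_nat_nat_iff)

lemma adj_relpow_sym: "(x, y) \<in> adj E ^^ k \<Longrightarrow> (y, x) \<in> adj E ^^ k"
proof (induction k arbitrary: y)
  case (Suc k)
  then obtain z where "(x, z) \<in> adj E ^^ k" "(z, y) \<in> adj E" by auto
  then have "(z, x) \<in> adj E ^^ k" "(y, z) \<in> adj E" using Suc.IH by (auto simp: adj_def insert_commute)
  then show ?case by (metis relpow_Suc_I2)
qed simp

lemma pwalk_relpow:
  assumes "pwalk n u v S x y p" "0 < n"
  shows "\<exists>k. (nat (x mod n), nat (y mod n)) \<in> adj (switched n u v S) ^^ k \<and> odd k = p"
  using assms(1)
proof (induction rule: pwalk.induct)
  case (cong x y)
  then show ?case using assms(2) by (intro exI[of _ 0]) (simp add: nat_mod_eq_iff)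
next
  case (straight x)
  then have "(nat (x mod n), nat ((x + u) mod n)) \<in> adj (switched n u v S)"
    unfolding adj_def switched_def by blast
  then show ?case by (intro exI[of _ 1]) auto
next
  case (cross x)
  then have "(nat (x mod n), nat ((x + v) mod n)) \<in> adj (switched n u v S)"
    unfolding adj_def switched_def by blast
  then show ?case by (intro exI[of _ 1]) auto
next
  case (sym x y p)
  then obtain k where "(nat (x mod n), nat (y mod n)) \<in> adj (switched n u v S) ^^ k" "odd k = p" by blast
  then show ?case by (intro exI[of _ k]) (simp add: adj_relpow_sym)
next
  case (trans x y p z q)
  then obtain k l where "(nat (x mod n), nat (y mod n)) \<in> adj (switched n u v S) ^^ k" "odd k = p"
    "(nat (y mod n), nat (z mod n)) \<in> adj (switched n u v S) ^^ l" "odd l = q" by blast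
  then show ?case by (intro exI[of _ "k + l"]) (auto intro: relpow_trans)
qed

lemma switched_neighbours:
  assumes "0 < n" "periodic n S"
  shows "{nat (x mod n), w} \<in> switched n u v S \<longleftrightarrow>
     w = nat ((x + u) mod n) \<and> x \<notin> S \<and> x - v \<notin> S \<or>
     w = nat ((x - u) mod n) \<and> x - u \<notin> S \<and> x - u - v \<notin> S \<or>
     w = nat ((x + v) mod n) \<and> (x \<in> S \<or> x - u \<in> S) \<or>
     w = nat ((x - v) mod n) \<and> (x - v \<in> S \<or> x - u - v \<in> S)" (is "?l \<longleftrightarrow> ?r")
proof
  have str: "{nat (y mod n), nat ((y + u) mod n)} \<in> switched n u v S" if "y \<notin> S" "y - v \<notin> S" for y
    unfolding switched_def using that by blast
  have crs: "{nat (y mod n), nat ((y + v) mod n)} \<in> switched n u v S" if "y \<in> S \<or> y - u \<in> S" for y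
    unfolding switched_def using that by blast
  have cd: "{nat ((x - v) mod n), nat (x mod n)} \<in> switched n u v S" if "x - v \<in> S \<or> x - u - v \<in> S"
    using crs[of "x - v"] that by (simp add: algebra_simps)
  assume ?r
  then show ?l using str[of x] str[of "x - u"] crs[of x] cd
    by (elim disjE conjE) (simp_all add: insert_commute)
next
  have S: "y - t \<in> S \<longleftrightarrow> x - t \<in> S" if "[y = x] (mod n)" for y t
    using that by (intro periodicD[OF assms(2)] cong_diff cong_refl)
  assume ?l
  then consider y where "{nat (x mod n), w} = {nat (y mod n), nat ((y + u) mod n)}" "y \<notin> S" "y - v \<notin> S"
    | y where "{nat (x mod n), w} = {nat (y mod n), nat ((y + v) mod n)}" "y \<in> S \<or> y - u \<in> S"
    unfolding switched_def by blast
  then show ?r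
  proof cases
    case 1
    then consider "[y = x] (mod n)" "w = nat ((y + u) mod n)" | "[y + u = x] (mod n)" "w = nat (y mod n)"
      using assms(1) by (auto simp: doubleton_eq_iff nat_mod_eq_iff cong_sym_eq)
    then show ?thesis
    proof cases
      case 1
      then have "w = nat ((x + u) mod n)" using assms(1) by (simp add: nat_mod_eq_iff cong_add_rcancel)
      then show ?thesis using S[OF 1(1), of 0] S[OF 1(1), of v] \<open>y \<notin> S\<close> \<open>y - v \<notin> S\<close> by simp
    next
      case 2
      then have c: "[y = x - u] (mod n)" by (simp add: cong_iff_dvd_diff algebra_simps)
      then have "w = nat ((x - u) mod n)" using assms(1) 2 by (simp add: nat_mod_eq_iff)
      moreover have "[y - v = x - u - v] (mod n)" using c by (intro cong_diff cong_refl)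
      ultimately show ?thesis using c periodicD[OF assms(2)] \<open>y \<notin> S\<close> \<open>y - v \<notin> S\<close> by blast
    qed
  next
    case 2
    then consider "[y = x] (mod n)" "w = nat ((y + v) mod n)" | "[y + v = x] (mod n)" "w = nat (y mod n)"
      using assms(1) by (auto simp: doubleton_eq_iff nat_mod_eq_iff cong_sym_eq)
    then show ?thesis
    proof cases
      case 1
      then have "w = nat ((x + v) mod n)" using assms(1) by (simp add: nat_mod_eq_iff cong_add_rcancel)
      then show ?thesis using S[OF 1(1), of 0] S[OF 1(1), of u] 2(2) by simp
    next
      case A: 2
      then have c: "[y = x - v] (mod n)" by (simp add: cong_iff_dvd_diff algebra_simps)
      then have "w = nat ((x - v) mod n)" using assms(1) A by (simp add: nat_mod_eq_iff)
      moreover have "[y - u = x - u - v] (mod n)" using c by (simp add: cong_iff_dvd_diff algebra_simps)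
      ultimately show ?thesis using c periodicD[OF assms(2)] 2(2) by blast
    qed
  qed
qed

text \<open>Squares at \<open>x\<close> and \<open>x + u\<close> share a \<open>v\<close>-edge,
  those at \<open>x\<close> and \<open>x + v\<close> a \<open>u\<close>-edge; so this is
  edge-disjointness of the squares.\<close>

definition sparse :: "int \<Rightarrow> int \<Rightarrow> int set \<Rightarrow> bool" where
  "sparse u v S \<longleftrightarrow> (\<forall>x\<in>S. x + u \<notin> S \<and> x + v \<notin> S)"

text \<open>\<open>A\<close>, \<open>B\<close>, \<open>C\<close>, \<open>D\<close> stand for
  \<open>x + u\<close>, \<open>x - u\<close>, \<open>x + v\<close>, \<open>x - v\<close>, and
  \<open>p\<close>, \<open>q\<close>, \<open>r\<close>, \<open>s\<close> for switching at
  \<open>x\<close>, \<open>x - v\<close>, \<open>x - u\<close>, \<open>x - u - v\<close>, the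
  squares around \<open>x\<close>. At most two opposite ones are switched, and each trades one
  \<open>u\<close>-neighbour for one \<open>v\<close>-neighbour.\<close>

lemma two_of_four:
  assumes "A \<noteq> B" "C \<noteq> D" "A \<noteq> C" "A \<noteq> D" "C \<noteq> B" "B \<noteq> D"
    and R: "R A" "R B" "R C" "R D"
    and "\<not> (p \<and> q)" "\<not> (p \<and> r)" "\<not> (q \<and> s)" "\<not> (r \<and> s)"
  shows "\<exists>y z. y \<noteq> z \<and> R y \<and> R z \<and>
    (\<forall>w. (w = A \<and> \<not> p \<and> \<not> q \<or> w = B \<and> \<not> r \<and> \<not> s \<or> w = C \<and> (p \<or> r) \<or> w = D \<and> (q \<or> s)) \<longleftrightarrow>
      w = y \<or> w = z)"
proof -
  consider "\<not> p" "\<not> q" "\<not> r" "\<not> s" | "p" "\<not> q" "\<not> r" "\<not> s" | "\<not> p" "q" "\<not> r" "\<not> s"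
    | "\<not> p" "\<not> q" "r" "\<not> s" | "\<not> p" "\<not> q" "\<not> r" "s" | "p \<and> s \<or> q \<and> r"
    using assms(11-14) by blast
  then show ?thesis
  proof cases
    case 1
    then show ?thesis using assms(1) R by (intro exI[of _ A] exI[of _ B]) blast
  next
    case 2
    then show ?thesis using assms(5) R by (intro exI[of _ B] exI[of _ C]) blast
  next
    case 3
    then show ?thesis using assms(6) R by (intro exI[of _ B] exI[of _ D]) blast
  next
    case 4
    then show ?thesis using assms(3) R by (intro exI[of _ A] exI[of _ C]) blast
  next
    case 5
    then show ?thesis using assms(4) R by (intro exI[of _ A] exI[of _ D]) blast
  next
    case 6
    then show ?thesis using assms(2) assms(11-14) R by (intro exI[of _ C] exI[of _ D]) blast
  qed
qed

lemma switched_cycle: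
  assumes n: "0 < n" and per: "periodic n S" and sp: "sparse u v S" and conn: "walk_connected n u v S"
    and ndvd: "\<not> n dvd u" "\<not> n dvd v" "\<not> n dvd 2 * u" "\<not> n dvd 2 * v" "\<not> n dvd u - v" "\<not> n dvd u + v"
  shows "\<exists>vs. distinct vs \<and> 3 \<le> length vs \<and> set vs = {0..<nat n} \<and> switched n u v S = cycle_edges vs"
proof (rule cycle_of_two_regular)
  have lt: "nat (x mod n) \<in> {0..<nat n}" for x using n by (simp add: nat_less_eq_zless)
  have vert: "\<exists>x. k = nat (x mod n)" if "k \<in> {0..<nat n}" for k
    using that by (intro exI[of _ "int k"]) (simp add: zless_nat_eq_int_zless)
  show "finite {0..<nat n}" "{0..<nat n} \<noteq> {}" using n by auto
  show "\<exists>y z. y \<noteq> z \<and> y \<noteq> k \<and> z \<noteq> k \<and> y \<in> {0..<nat n} \<and> z \<in> {0..<nat n} \<and>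
      (\<forall>w. {k, w} \<in> switched n u v S \<longleftrightarrow> w = y \<or> w = z)" if k: "k \<in> {0..<nat n}" for k
  proof -
    obtain x where x: "k = nat (x mod n)" using vert[OF k] by blast
    have ne: "nat ((x + s) mod n) \<noteq> nat ((x + t) mod n)" if "\<not> n dvd s - t" for s t
      using that n by (simp add: nat_mod_eq_iff cong_iff_dvd_diff)
    have pm: "nat ((x + s) mod n) \<noteq> nat ((x - t) mod n)" if "\<not> n dvd s + t" for s t
      using ne[of s "- t"] that by simp
    have m: "\<not> n dvd - u" "\<not> n dvd - v" "\<not> n dvd - u - - v" "\<not> n dvd v + u"
      "\<not> n dvd u + u" "\<not> n dvd v + v"
      using ndvd(1) ndvd(2) ndvd(5) dvd_diff_commute[of n u v] ndvd(6) add.commute[of u v] ndvd(3) ndvd(4)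
      unfolding mult_2 by simp_all
    have dist: "nat ((x + u) mod n) \<noteq> nat ((x - u) mod n)" "nat ((x + v) mod n) \<noteq> nat ((x - v) mod n)"
      "nat ((x + u) mod n) \<noteq> nat ((x + v) mod n)" "nat ((x + u) mod n) \<noteq> nat ((x - v) mod n)"
      "nat ((x + v) mod n) \<noteq> nat ((x - u) mod n)" "nat ((x - u) mod n) \<noteq> nat ((x - v) mod n)"
      using pm[OF m(5)] pm[OF m(6)] ne[OF ndvd(5)] pm[OF ndvd(6)] pm[OF m(4)] ne[OF m(3)]
      by (simp_all only: add_uminus_conv_diff not_False_eq_True)
    have nk: "nat ((x + s) mod n) \<noteq> k" if "\<not> n dvd s" for s using ne[of s 0] that by (simp add: x)
    have dist': "nat ((x + u) mod n) \<noteq> k" "nat ((x - u) mod n) \<noteq> k" "nat ((x + v) mod n) \<noteq> k" "nat ((x - v) mod n) \<noteq> k"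
      using nk[OF ndvd(1)] nk[OF ndvd(2)] nk[OF m(1)] nk[OF m(2)] by simp_all
    have ex: "\<not> (x \<in> S \<and> x - v \<in> S)" "\<not> (x \<in> S \<and> x - u \<in> S)"
      "\<not> (x - v \<in> S \<and> x - u - v \<in> S)" "\<not> (x - u \<in> S \<and> x - u - v \<in> S)"
    proof -
      have e: "x - v + v = x" "x - u + u = x" "x - u - v + u = x - v" "x - u - v + v = x - u" by simp_all
      have "y \<in> S \<longrightarrow> y + u \<notin> S" "y \<in> S \<longrightarrow> y + v \<notin> S" for y using sp by (auto simp: sparse_def)
      from this(2)[of "x - v"] this(1)[of "x - u"] this(1)[of "x - u - v"] this(2)[of "x - u - v"]
      show "\<not> (x \<in> S \<and> x - v \<in> S)" "\<not> (x \<in> S \<and> x - u \<in> S)"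
        "\<not> (x - v \<in> S \<and> x - u - v \<in> S)" "\<not> (x - u \<in> S \<and> x - u - v \<in> S)" unfolding e by blast+
    qed
    have "\<exists>y z. y \<noteq> z \<and> (y \<noteq> k \<and> y \<in> {0..<nat n}) \<and> (z \<noteq> k \<and> z \<in> {0..<nat n}) \<and>
        (\<forall>w. {k, w} \<in> switched n u v S \<longleftrightarrow> w = y \<or> w = z)"
      unfolding x switched_neighbours[OF n per]
      by (rule two_of_four[OF dist _ _ _ _ ex]) (intro conjI lt, rule dist'[unfolded x])+
    then show ?thesis by blast
  qed
  show "\<exists>x y. e = {x, y} \<and> x \<in> {0..<nat n}" if "e \<in> switched n u v S" for e
    using that lt unfolding switched_def by blast
  show "(k, l) \<in> (adj (switched n u v S))\<^sup>*" if kl: "k \<in> {0..<nat n}" "l \<in> {0..<nat n}" for k l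
  proof -
    obtain x y where xy: "k = nat (x mod n)" "l = nat (y mod n)" using vert[OF kl(1)] vert[OF kl(2)] by blast
    obtain p where "pwalk n u v S x y p" using conn by (auto simp: walk_connected_def)
    from pwalk_relpow[OF this n] show ?thesis unfolding xy by (auto intro: relpow_imp_rtrancl)
  qed
qed

section \<open>Edges of the circulant graph and the switching criterion\<close>

definition jump_edges :: "int \<Rightarrow> int \<Rightarrow> nat set set" where
  "jump_edges n j = {{nat (x mod n), nat ((x + j) mod n)} | x. True}"

lemma jump_edges_uminus: "jump_edges n (- j) = jump_edges n j"
proof -
  have "jump_edges n (- j) \<subseteq> jump_edges n j" for j
  proof
    fix e assume "e \<in> jump_edges n (- j)"
    then obtain x where "e = {nat (x mod n), nat ((x - j) mod n)}" by (auto simp: jump_edges_def)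
    then have "e = {nat ((x - j) mod n), nat ((x - j + j) mod n)}" by auto
    then show "e \<in> jump_edges n j" unfolding jump_edges_def by blast
  qed
  from this[of j] this[of "- j"] show ?thesis by auto
qed

lemma edges_Circ:
  assumes "0 < n"
  shows "edges (Circ n {a, b}) = jump_edges (int n) (int a) \<union> jump_edges (int n) (int b)"
proof -
  have E: "jump_edges (int n) (int j) =
      {{x, y} | x y. x < n \<and> y < n \<and> ([y = x + j] (mod n) \<or> [x = y + j] (mod n))}" for j
  proof (intro subset_antisym subsetI)
    fix e assume "e \<in> jump_edges (int n) (int j)"
    then obtain z where z: "e = {nat (z mod int n), nat ((z + int j) mod int n)}" by (auto simp: jump_edges_def)
    have "[int (nat ((z + int j) mod int n)) = int (nat (z mod int n) + j)] (mod int n)"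
      using assms by (simp add: cong_def mod_simps)
    then have "[nat ((z + int j) mod int n) = nat (z mod int n) + j] (mod n)" by (simp only: cong_int_iff)
    moreover have "nat (z mod int n) < n" "nat ((z + int j) mod int n) < n"
      using assms by (simp_all add: nat_less_iff)
    ultimately show "e \<in> {{x, y} | x y. x < n \<and> y < n \<and> ([y = x + j] (mod n) \<or> [x = y + j] (mod n))}"
      using z by blast
  next
    have *: "{x, y} \<in> jump_edges (int n) (int j)" if "x < n" "y < n" "[y = x + j] (mod n)" for x y
    proof -
      have "int y = (int x + int j) mod int n"
        using that by (simp add: cong_def zmod_int flip: of_nat_add)
      then have "{x, y} = {nat (int x mod int n), nat ((int x + int j) mod int n)}"
        using that(1) by (simp flip: \<open>int y = _\<close>)
      then show ?thesis unfolding jump_edges_def by blast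
    qed
    fix e assume "e \<in> {{x, y} | x y. x < n \<and> y < n \<and> ([y = x + j] (mod n) \<or> [x = y + j] (mod n))}"
    then obtain x y where e: "e = {x, y}" "x < n" "y < n" "[y = x + j] (mod n) \<or> [x = y + j] (mod n)" by blast
    then show "e \<in> jump_edges (int n) (int j)" using *[of x y] *[of y x] by (auto simp: insert_commute)
  qed
  show ?thesis unfolding E Circ_def by auto
qed

lemma switched_Un: "switched n u v S \<union> switched n v u S = jump_edges n u \<union> jump_edges n v"
  unfolding switched_def jump_edges_def by blast

text \<open>As \<open>n\<close> is even, residues have a parity: \<open>u\<close>-edges join unlike
  and \<open>v\<close>-edges like parities. Among edges of one jump the starting residue is unique
  because twice the jump is nonzero.\<close>

lemma switched_Int:
  assumes n: "0 < n" "even n" and "odd u" "even v" and per: "periodic n S"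
    and 2: "\<not> n dvd 2 * u" "\<not> n dvd 2 * v"
  shows "switched n u v S \<inter> switched n v u S = {}"
proof -
  have par: "even (nat (x mod n)) = even x" for x using n by (simp add: even_nat_iff dvd_mod_iff)
  have mixed: "{nat (x mod n), nat ((x + u) mod n)} \<noteq> {nat (y mod n), nat ((y + v) mod n)}" for x y
  proof
    assume "{nat (x mod n), nat ((x + u) mod n)} = {nat (y mod n), nat ((y + v) mod n)}"
    then have "even (nat (x mod n)) = even (nat ((x + u) mod n))"
      using assms(4) par[of y] par[of "y + v"] by (auto simp: doubleton_eq_iff)
    then show False using assms(3) par[of x] par[of "x + u"] by simp
  qed
  have same: "[x = y] (mod n)"
    if "\<not> n dvd 2 * t" "{nat (x mod n), nat ((x + t) mod n)} = {nat (y mod n), nat ((y + t) mod n)}" for x y t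
  proof (rule ccontr)
    assume "\<not> [x = y] (mod n)"
    then have "[x = y + t] (mod n)" "[x + t = y] (mod n)"
      using that(2) n by (auto simp: doubleton_eq_iff nat_mod_eq_iff)
    then have "n dvd (x + t - y) - (x - (y + t))" unfolding cong_iff_dvd_diff by (rule dvd_diff[rotated])
    then show False using that(1) by (simp add: algebra_simps)
  qed
  have same_S: False
    if "\<not> n dvd 2 * t" "{nat (x mod n), nat ((x + t) mod n)} = {nat (y mod n), nat ((y + t) mod n)}"
      "x \<notin> S" "x - s \<notin> S" "y \<in> S \<or> y - s \<in> S" for x y s t
  proof -
    have c: "[x = y] (mod n)" by (rule same[OF that(1,2)])
    then have "[x - s = y - s] (mod n)" by (intro cong_diff cong_refl)
    then show False using c periodicD[OF per] that(3-5) by blast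
  qed
  show ?thesis
  proof (rule ccontr)
    assume "switched n u v S \<inter> switched n v u S \<noteq> {}"
    then obtain e where e: "e \<in> switched n u v S" "e \<in> switched n v u S" by blast
    consider x where "e = {nat (x mod n), nat ((x + u) mod n)}" "x \<notin> S" "x - v \<notin> S"
      | x where "e = {nat (x mod n), nat ((x + v) mod n)}" "x \<in> S \<or> x - u \<in> S"
      using e(1) unfolding switched_def by blast
    note 1 = this
    consider y where "e = {nat (y mod n), nat ((y + v) mod n)}" "y \<notin> S" "y - u \<notin> S"
      | y where "e = {nat (y mod n), nat ((y + u) mod n)}" "y \<in> S \<or> y - v \<in> S"
      using e(2) unfolding switched_def by blast
    note 3 = this
    show False
    proof (rule 1)
      fix x assume x: "e = {nat (x mod n), nat ((x + u) mod n)}" "x \<notin> S" "x - v \<notin> S"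
      show False
      proof (rule 3)
        fix y assume y: "e = {nat (y mod n), nat ((y + v) mod n)}"
        then show False using mixed[of x y] x(1) by simp
      next
        fix y assume y: "e = {nat (y mod n), nat ((y + u) mod n)}" "y \<in> S \<or> y - v \<in> S"
        show False by (rule same_S[OF 2(1) _ x(2,3) y(2)]) (simp only: x(1)[symmetric] y(1)[symmetric])
      qed
    next
      fix x assume x: "e = {nat (x mod n), nat ((x + v) mod n)}" "x \<in> S \<or> x - u \<in> S"
      show False
      proof (rule 3)
        fix y assume y: "e = {nat (y mod n), nat ((y + v) mod n)}" "y \<notin> S" "y - u \<notin> S"
        show False by (rule same_S[OF 2(2) _ y(2,3) x(2)]) (simp only: x(1)[symmetric] y(1)[symmetric])
      next
        fix y assume "e = {nat (y mod n), nat ((y + u) mod n)}"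
        then show False using mixed[of y x] x(1) by simp
      qed
    qed
  qed
qed

text \<open>The square at \<open>w\<close> alternates if it is switched itself, or if none of its
  edges is switched; the five excluded corners are its own and those of the squares sharing an edge
  with it.\<close>

definition Q2_switching :: "int \<Rightarrow> int \<Rightarrow> int \<Rightarrow> bool" where
  "Q2_switching n u v \<longleftrightarrow> (\<exists>S w. periodic n S \<and> sparse u v S \<and>
     walk_connected n u v S \<and> walk_connected n v u S \<and>
     (w \<in> S \<or> {w, w + u, w - u, w + v, w - v} \<inter> S = {}) \<and>
     pwalk n u v S w (w + u + v) True \<and> pwalk n v u S w (w + u + v) True)"

text \<open>A sign does not change the edges of a jump but does change which vertices form a square
  with corner \<open>x\<close>, hence the freedom in \<open>u\<close> and \<open>v\<close>.\<close>

lemma Q2_switching_imp: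
  assumes "Q2_switching (int n) u v" and "even n" "odd u" "even v"
    and 2: "\<not> int n dvd 2 * u" "\<not> int n dvd 2 * v"
    and uv: "u = int a \<or> u = - int a" "v = int b \<or> v = - int b" and "0 < n"
  shows "\<exists>H1 H2. hamilton_decomposition (Circ n {a, b}) H1 H2 \<and> property_Q2 (Circ n {a, b}) H1 H2"
proof -
  obtain S w where S: "periodic (int n) S" "sparse u v S" "walk_connected (int n) u v S"
     "walk_connected (int n) v u S" "w \<in> S \<or> {w, w + u, w - u, w + v, w - v} \<inter> S = {}"
     "pwalk (int n) u v S w (w + u + v) True" "pwalk (int n) v u S w (w + u + v) True"
    using assms(1) unfolding Q2_switching_def by blast
  let ?G = "Circ n {a, b}"
  let ?H1 = "switched (int n) u v S" and ?H2 = "switched (int n) v u S"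
  let ?r = "\<lambda>x. nat (x mod int n)"
  have n: "0 < int n" "even (int n)" using assms by auto
  have oddp: "\<not> int n dvd x" if "odd x" for x using that n(2) dvd_trans by blast
  have nd: "\<not> int n dvd u" "\<not> int n dvd v" "\<not> int n dvd u - v" "\<not> int n dvd u + v"
    "\<not> int n dvd v - u" "\<not> int n dvd v + u"
    using assms(3,4) 2(2) oddp dvd_mult[of "int n" v 2] by auto
  have edges: "?H1 \<union> ?H2 = edges ?G"
    using uv jump_edges_uminus[of "int n" "int a"] jump_edges_uminus[of "int n" "int b"]
    unfolding switched_Un edges_Circ[OF \<open>0 < n\<close>] by auto
  have verts: "verts ?G = {0..<n}" by (simp add: Circ_def)
  have "sparse v u S" using S(2) by (auto simp: sparse_def)
  obtain vs1 where vs1: "distinct vs1" "3 \<le> length vs1" "set vs1 = {0..<n}" "?H1 = cycle_edges vs1"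
    using switched_cycle[OF n(1) S(1,2,3) nd(1,2) 2 nd(3,4)] by auto
  obtain vs2 where vs2: "distinct vs2" "3 \<le> length vs2" "set vs2 = {0..<n}" "?H2 = cycle_edges vs2"
    using switched_cycle[OF n(1) S(1) \<open>sparse v u S\<close> S(4) nd(2,1) 2(2,1) nd(5,6)] by auto
  have len: "length vs1 = n" "length vs2 = n"
    using vs1(1,3) vs2(1,3) distinct_card[of vs1] distinct_card[of vs2] by auto
  have dec: "hamilton_decomposition ?G ?H1 ?H2"
    unfolding hamilton_decomposition_def hamilton_cycle_def verts
    using vs1 vs2 edges switched_Int[OF n assms(3,4) S(1) 2] by blast
  have od: "odd (graph_dist ?H1 (?r w) (?r (w + u + v)))" "odd (graph_dist ?H2 (?r w) (?r (w + u + v)))"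
    using pwalk_relpow[OF S(6) n(1)] pwalk_relpow[OF S(7) n(1)] odd_graph_dist_cycle
      vs1(1,4) vs2(1,4) len \<open>even n\<close> by metis+
  have ne: "?r x \<noteq> ?r y" if "\<not> int n dvd x - y" for x y
    using that n(1) by (simp add: nat_mod_eq_iff cong_iff_dvd_diff)
  have "distinct [?r w, ?r (w + u), ?r (w + u + v), ?r (w + v)]"
  proof -
    have "\<not> int n dvd w - (w + u)" "\<not> int n dvd w - (w + u + v)" "\<not> int n dvd w - (w + v)"
      "\<not> int n dvd w + u - (w + u + v)" "\<not> int n dvd w + u - (w + v)" "\<not> int n dvd w + u + v - (w + v)"
      using nd assms(3,4) oddp[of "w - (w + u + v)"] by simp_all
    from this[THEN ne] show ?thesis by simp
  qed
  moreover have "{?r w, ?r (w + u), ?r (w + u + v), ?r (w + v)} \<subseteq> verts ?G"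
    using n(1) \<open>0 < n\<close> by (simp add: verts nat_less_iff)
  moreover have alt: "{?r w, ?r (w + u)} \<in> ?H1 \<and> {?r (w + u + v), ?r (w + v)} \<in> ?H1 \<and>
        {?r (w + u), ?r (w + u + v)} \<in> ?H2 \<and> {?r (w + v), ?r w} \<in> ?H2 \<or>
      {?r w, ?r (w + u)} \<in> ?H2 \<and> {?r (w + u + v), ?r (w + v)} \<in> ?H2 \<and>
        {?r (w + u), ?r (w + u + v)} \<in> ?H1 \<and> {?r (w + v), ?r w} \<in> ?H1"
  proof -
    have st: "{?r x, ?r (x + s)} \<in> switched (int n) s t S" if "x \<notin> S" "x - t \<notin> S" for x s t
      using that unfolding switched_def by blast
    have cr: "{?r x, ?r (x + t)} \<in> switched (int n) s t S" if "x \<in> S \<or> x - s \<in> S" for x s t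
      using that unfolding switched_def by blast
    have e: "w + v + u = w + u + v" "w + v - v = w" "w + u - u = w" by simp_all
    from S(5) show ?thesis
    proof
      assume "w \<in> S"
      then show ?thesis
        using cr[of w v u] cr[of "w + v" v u] cr[of "w + u" u v] cr[of w u v]
        unfolding e by (auto simp: insert_commute)
    next
      assume "{w, w + u, w - u, w + v, w - v} \<inter> S = {}"
      then show ?thesis
        using st[of w v u] st[of "w + v" v u] st[of "w + u" u v] st[of w u v]
        unfolding e by (auto simp: insert_commute)
    qed
  qed
  ultimately have "odd_alternating_4_cycle ?G ?H1 ?H2 (?r w) (?r (w + u)) (?r (w + u + v)) (?r (w + v))"
    unfolding odd_alternating_4_cycle_def alternating_4_cycle_def four_cycle_def
    using od edges by blast
  then have "property_Q2 ?G ?H1 ?H2" unfolding property_Q2_def by blast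
  with dec show ?thesis by blast
qed

section \<open>Edge-disjointness of the squares and a 2-colouring\<close>

lemma zigzag_row_Suc: "1 \<le> M \<Longrightarrow> zigzag_row M (Suc g) = zigzag_row M g + 1 \<or> zigzag_row M (Suc g) = zigzag_row M g - 1"
proof -
  assume M: "1 \<le> M"
  consider "Suc g < M" | "Suc g = M" | "M \<le> g" by linarith
  then show ?thesis
  proof cases
    case 3
    then have "Suc g - M + 1 = Suc (g - M + 1)" by simp
    moreover have "int (Suc k mod 2) = 1 - int (k mod 2)" for k by (simp add: mod_Suc)
    ultimately show ?thesis using 3 by (simp add: zigzag_row_def mod_Suc)
  qed (use M in \<open>auto simp: zigzag_row_def\<close>)
qed

context jumps
begin

text \<open>Consecutive heights differ by one, so squares on neighbouring lines share no edge. The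
  step from the last line to the first needs its own hypothesis if every line carries a
  square.\<close>

lemma sparse_corners:
  assumes M: "1 \<le> M" and N: "int N \<le> lines" and v: "\<not> n dvd v"
    and wrap: "int N = lines \<Longrightarrow> \<not> n dvd lines * u + (zigzag_row M (N - 1) - zigzag_row M 0) * v"
  shows "sparse u v (corners n u v M N)"
  unfolding sparse_def
proof (intro ballI conjI)
  fix x assume "x \<in> corners n u v M N"
  then obtain g where g: "g < N" "[x = int g * u + zigzag_row M g * v] (mod n)" by (auto simp: corners_def)
  have gl: "int g < lines" using g N by linarith
  note per = periodicD[OF periodic_corners]
  have "[x + v = int g * u + (zigzag_row M g + 1) * v] (mod n)"
    using g(2) by (simp add: cong_iff_dvd_diff algebra_simps)
  moreover have "int g * u + (zigzag_row M g + 1) * v \<notin> corners n u v M N" using mem_corners[of "int g" N] gl N v by auto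
  ultimately show "x + v \<notin> corners n u v M N" using per by blast
  have xu: "[x + u = int (Suc g) * u + zigzag_row M g * v] (mod n)"
    using g(2) by (simp add: cong_iff_dvd_diff algebra_simps)
  have "int (Suc g) * u + zigzag_row M g * v \<notin> corners n u v M N"
  proof (cases "int (Suc g) < lines")
    case True
    have "\<not> n dvd (zigzag_row M g - zigzag_row M (Suc g)) * v" using zigzag_row_Suc[OF M, of g] v by auto
    moreover have "nat (int (Suc g)) = Suc g" by simp
    ultimately show ?thesis using mem_corners[OF _ True N, of "zigzag_row M g" M] by (metis of_nat_0_le_iff)
  next
    case False
    then have e: "int (Suc g) = lines" "N = Suc g" using gl g(1) N by auto
    show ?thesis
    proof
      assume "int (Suc g) * u + zigzag_row M g * v \<in> corners n u v M N"
      then obtain h where h: "h < N" "[int (Suc g) * u + zigzag_row M g * v = int h * u + zigzag_row M h * v] (mod n)"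
        by (auto simp: corners_def)
      then have "[lines = int h] (mod lines)" using line_index e(1) by metis
      then have "lines dvd int h" by (metis cong_def mod_self dvd_eq_mod_eq_0)
      then have "h = 0" using h(1) N zdvd_not_zless[of "int h" lines] by (cases "h = 0") auto
      then have "n dvd lines * u + (zigzag_row M (N - 1) - zigzag_row M 0) * v"
        using h(2)[unfolded e(1)] e(2) by (simp add: cong_iff_dvd_diff algebra_simps)
      then show False using wrap e by simp
    qed
  qed
  then show "x + u \<notin> corners n u v M N" using xu per by blast
qed

lemma lines_distinct:
  assumes "0 \<le> i" "i < i'" "i' < lines"
  shows "\<not> [i * u + j * v = i' * u + j' * v] (mod n)"
  using index_unique[of i j i' j'] assms by fastforce

lemma last_line:
  obtains e where "[lines * u = e * v] (mod n)"
    "\<And>j. [- u + j * v = (lines - 1) * u + (j - e) * v] (mod n)"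
proof -
  obtain e where e: "[lines * u = e * v] (mod n)" using line_shift by blast
  have "[- u + j * v = (lines - 1) * u + (j - e) * v] (mod n)" for j
    using e by (simp add: cong_iff_dvd_diff algebra_simps dvd_diff_commute)
  with e that show ?thesis by blast
qed

text \<open>The parity of \<open>i + j\<close> at \<open>i u + j v\<close> is a proper 2-colouring, as no walk crosses from the last line to the first.\<close>

lemma walk_parity:
  assumes "even len" and last: "\<And>j. - u + j * v \<notin> S" and per: "periodic n S"
    and "pwalk n v u S x y p"
  shows "\<And>i j i' j'. 0 \<le> i \<Longrightarrow> i < lines \<Longrightarrow> 0 \<le> i' \<Longrightarrow> i' < lines \<Longrightarrow> [x = i * u + j * v] (mod n) \<Longrightarrow>
    [y = i' * u + j' * v] (mod n) \<Longrightarrow> p \<longleftrightarrow> odd (i + j + i' + j')"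
proof -
  have *: "i = i' \<and> even (j - j')"
    if "[x = i * u + j * v] (mod n)" "[x = i' * u + j' * v] (mod n)" "0 \<le> i" "i < lines" "0 \<le> i'" "i' < lines"
    for x i i' j j'
  proof -
    have c: "[i * u + j * v = i' * u + j' * v] (mod n)" using that(1,2) cong_sym cong_trans by blast
    then have "i = i'" using that(3-) index_unique by blast
    then have "n dvd (j - j') * v" using c by (simp add: cong_iff_dvd_diff algebra_simps)
    then have "len dvd j - j'" by (simp add: len_dvd)
    then show ?thesis using \<open>even len\<close> \<open>i = i'\<close> dvd_trans by blast
  qed
  from assms(4) show "p \<longleftrightarrow> odd (i + j + i' + j')"
    if "0 \<le> i" "i < lines" "0 \<le> i'" "i' < lines" "[x = i * u + j * v] (mod n)" "[y = i' * u + j' * v] (mod n)"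
    for i j i' j'
    using that
  proof (induction arbitrary: i j i' j' rule: pwalk.induct)
    case (cong x y)
    then have "[x = i' * u + j' * v] (mod n)" using cong_trans by blast
    from *[OF cong.prems(5) this cong.prems(1-4)] show ?case by auto
  next
    case (straight x)
    have "[x + v = i * u + (j + 1) * v] (mod n)"
      using straight.prems(5) by (simp add: cong_iff_dvd_diff algebra_simps)
    from *[OF this straight.prems(6,1-4)] show ?case by auto
  next
    case (cross x)
    \<comment> \<open>A crossing edge out of the last line would belong to a square with corner of
      the form \<open>- u + j * v\<close>.\<close>
    have "i \<noteq> lines - 1"
    proof
      assume i: "i = lines - 1"
      obtain e where e: "\<And>j. [- u + j * v = (lines - 1) * u + (j - e) * v] (mod n)" using last_line by blast
      have x: "[x = - u + (j + e) * v] (mod n)"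
        using cross.prems(5) e[of "j + e"] unfolding i by (simp add: cong_def)
      then have "[x - v = - u + (j + e - 1) * v] (mod n)" by (simp add: cong_iff_dvd_diff algebra_simps)
      then show False using x cross.hyps last periodicD[OF per] by blast
    qed
    then have "i + 1 < lines" using cross.prems(2) by linarith
    moreover have "[x + u = (i + 1) * u + j * v] (mod n)"
      using cross.prems(5) by (simp add: cong_iff_dvd_diff algebra_simps)
    ultimately have "i + 1 = i' \<and> even (j - j')" using *[OF _ cross.prems(6)] cross.prems(1,3,4) by simp
    then show ?case by auto
  next
    case (sym x y p)
    then show ?case using sym.IH[of i' i j' j] by (simp add: algebra_simps)
  next
    case (trans x y p z q)
    obtain k l where kl: "0 \<le> k" "k < lines" "[y = k * u + l * v] (mod n)" using line_rep by blast
    have "odd (i + j + i' + j') \<longleftrightarrow> odd (i + j + k + l) \<noteq> odd (k + l + i' + j')" by presburger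
    then show ?case using trans.IH(1)[OF trans.prems(1,2) kl(1,2) trans.prems(5) kl(3)]
        trans.IH(2)[OF kl(1,2) trans.prems(3,4) kl(3) trans.prems(6)] by blast
  qed
qed

end

section \<open>Odd alternating squares\<close>

locale odd_even_jumps =
  fixes n a b :: int
  assumes n: "0 < n" "even n" and ab: "odd a" "even b" and cop: "gcd (gcd a b) n = 1"
    and a2: "\<not> n dvd 2 * a" and b2: "\<not> n dvd 2 * b"
begin

text \<open>\<open>A\<close> sees \<open>b\<close>-cycles linked by \<open>a\<close>-edges,
  \<open>B\<close> sees \<open>a\<close>-cycles linked by \<open>b\<close>-edges. So
  \<open>A.lines\<close> is \<open>gcd b n\<close>, and \<open>A.len\<close> is the length of a
  \<open>b\<close>-cycle.\<close>

sublocale A: jumps n a b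
  using n cop by unfold_locales

sublocale B: jumps n b a
  using n cop by unfold_locales (simp_all add: gcd.commute)

definition c :: nat where "c = nat (gcd a n)"
definition d :: nat where "d = nat (gcd b n)"

lemma int_c: "int c = gcd a n" and int_d: "int d = gcd b n"
  by (simp_all add: c_def d_def)

lemma odd_c: "odd c"
proof -
  have "odd (gcd a n)" using ab(1) dvd_trans gcd_dvd1 by blast
  then show ?thesis by (simp flip: int_c)
qed

lemma even_d: "even d"
proof -
  have "even (gcd b n)" using ab(2) n(2) by simp
  then show ?thesis by (simp flip: int_d)
qed

lemma d_pos: "2 \<le> d"
proof -
  have "d \<noteq> 0" using A.lines_pos int_d by linarith
  then show ?thesis using even_d by presburger
qed

lemma c_pos: "1 \<le> c" using odd_c by (cases "c = 0") auto

lemma not_dvd: "\<not> n dvd a" "\<not> n dvd b"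
  using a2 b2 dvd_mult by blast+

lemma zero_mem_corners: "0 < N \<Longrightarrow> 1 \<le> M \<Longrightarrow> 0 \<in> corners n u v M N"
  using cornersI[of 0 N u M v n] by (simp add: zigzag_row_def)

lemma connected_few_odd:
  assumes "c < d"
  defines "S \<equiv> corners n a b c (d - 1)"
  shows "periodic n S" "sparse a b S" "walk_connected n a b S" "walk_connected n b a S"
    and "3 \<le> c \<Longrightarrow> pwalk n a b S 0 (a + b) True"
proof -
  show "periodic n S" unfolding S_def by (rule periodic_corners)
  have d1: "int (d - 1) + 1 = gcd b n" using d_pos int_d by linarith
  show "sparse a b S" unfolding S_def
    by (rule A.sparse_corners) (use d1 c_pos not_dvd in auto)
  show "walk_connected n b a S" unfolding S_def by (rule A.path_connected[OF d1])
  define h where "h = (d - 1 - c) div 2"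
  have "even (d - 1 - c)" using odd_c even_d d_pos by simp
  then have h: "d - 1 = c + 2 * h" using assms(1) d_pos by (simp add: h_def)
  have le: "int c + 2 * int h \<le> gcd b n" using h d1 by linarith
  note cyc = B.cyclic_odd_and_connected[OF int_c odd_c n(2) ab(2,1), where M = c]
  note comm = corners_staircase_commute[of n a b c]
  show "walk_connected n a b S"
    unfolding S_def h by (rule A.zigzag_family_connected[OF c_pos le b2]) (unfold comm, rule cyc(2))
  assume c3: "3 \<le> c"
  have w: "pwalk n a b (corners n a b c c) 0 (a + b) True"
    using cyc(1)[OF zero_mem_corners] c_pos by (simp add: comm add.commute)
  show "pwalk n a b S 0 (a + b) True"
    unfolding S_def h
  proof (rule A.zigzag_family_walk[OF c_pos le b2 w])
    fix w i j assume w: "w \<in> {0, a + b}" and i: "int c \<le> i" "i < int c + 2 * int h"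
    then have l: "0 < i" "1 < i" "i < gcd b n" using le c3 by linarith+
    from w consider "w = 0 * a + 0 * b" | "w = 1 * a + 1 * b" by auto
    then show "\<not> [w = i * a + j * b] (mod n)"
      using A.lines_distinct[OF _ l(1,3), of 0 j] A.lines_distinct[OF _ l(2,3), of 1 j] by cases simp_all
  qed
qed

text \<open>The roles are exchanged: the first \<open>d - 1\<close> squares link the
  \<open>b\<close>-cycles in a path, zigzags extend them to \<open>c\<close> squares, and the cyclic
  argument for the \<open>a\<close>-cycles applies to arbitrary \<open>M\<close>.\<close>

lemma connected_few_even:
  assumes "d < c"
  defines "S \<equiv> corners n b a (d - 1) c"
  shows "periodic n S" "sparse a b S" "walk_connected n a b S" "walk_connected n b a S"
    and "pwalk n a b S 0 (a + b) True"
proof -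
  show "periodic n S" unfolding S_def by (rule periodic_corners)
  have d1: "int (d - 1) + 1 = gcd b n" "1 \<le> d - 1" using d_pos int_d by linarith+
  define h where "h = (c - (d - 1)) div 2"
  have "even (c - (d - 1))" using odd_c even_d d_pos by simp
  then have h: "c = d - 1 + 2 * h" using assms(1) d_pos by (simp add: h_def)
  have le: "int (d - 1) + 2 * int h \<le> gcd a n" using h int_c by linarith
  note cyc = B.cyclic_odd_and_connected[OF int_c odd_c n(2) ab(2,1), where M = "d - 1"]
  show "walk_connected n a b S" unfolding S_def by (rule cyc(2))
  show "pwalk n a b S 0 (a + b) True"
    unfolding S_def using cyc(1)[OF zero_mem_corners] c_pos d1(2) by (simp add: add.commute)
  have "walk_connected n b a (corners n b a (d - 1) (d - 1))"
    unfolding corners_staircase_commute[of n b a] by (rule A.path_connected[OF d1(1)])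
  from B.zigzag_family_connected[OF d1(2) le a2 this] show "walk_connected n b a S"
    unfolding S_def using h by simp
  have z: "zigzag_row (d - 1) (c - 1) = int d - 2"
  proof -
    have "c - 1 - (d - 1) + 1 = 2 * h" "\<not> c - 1 < d - 1" using h assms(1) d_pos by linarith+
    then show ?thesis unfolding zigzag_row_def using d_pos by simp
  qed
  have "sparse b a S" unfolding S_def
  proof (rule B.sparse_corners)
    have "zigzag_row (d - 1) 0 = 0" using d1(2) by (simp add: zigzag_row_def)
    show "\<not> n dvd gcd a n * b + (zigzag_row (d - 1) (c - 1) - zigzag_row (d - 1) 0) * a"
      unfolding z \<open>zigzag_row (d - 1) 0 = 0\<close>
    proof
      \<comment> \<open>The last square has height \<open>d - 2\<close>. Meeting the first one
        forces \<open>d = 2\<close>; then \<open>n\<close> divides \<open>2 * c\<close>, hence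
        \<open>2 * a\<close>.\<close>
      assume *: "n dvd gcd a n * b + (int d - 2 - 0) * a"
      then have "[(int d - 2) * a + gcd a n * b = 0 * a + 0 * b] (mod n)"
        by (simp add: cong_iff_dvd_diff algebra_simps)
      moreover have "0 \<le> int d - 2" "int d - 2 < gcd b n" "0 < gcd b n" using d1 int_d by linarith+
      ultimately have "int d - 2 = 0" using A.index_unique by blast
      then have "n dvd gcd a n * b" and d2: "gcd b n = 2" using * int_d by auto
      then have "n div 2 dvd gcd a n" using A.len_dvd by simp
      then have "n div 2 * 2 dvd gcd a n * 2" by (rule mult_dvd_mono) simp
      then have "n dvd gcd a n * 2" using n(2) by simp
      moreover have "gcd a n * 2 dvd a * 2" by (rule mult_dvd_mono) simp_all
      ultimately show False using a2 dvd_trans by (metis mult.commute)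
    qed
  qed (use d1 not_dvd int_c in auto)
  then show "sparse a b S" by (auto simp: sparse_def)
qed

end

section \<open>Odd walks in the factor of the even jump\<close>

lemma zigzag_row_ge: "M \<le> g \<Longrightarrow> zigzag_row M g = int M - 1 \<or> zigzag_row M g = int M - 2"
  by (simp add: zigzag_row_def) presburger

lemma zigzag_row_top: "M \<le> g \<Longrightarrow> odd (g - M) \<Longrightarrow> zigzag_row M g = int M - 1"
  by (simp add: zigzag_row_def)

context odd_even_jumps
begin

lemma odd_walk_first_line:
  assumes per: "periodic n S" and zero: "0 \<in> S" and last: "\<And>j. - a + j * b \<notin> S"
    and first: "\<And>j. j * b \<in> S \<Longrightarrow> n dvd j * b" and "odd A.len"
  shows "pwalk n b a S 0 (a + b) True"
proof -
  define m where "m = nat A.len"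
  have m: "int m = A.len" using A.len_pos by (simp add: m_def)
  have "pwalk n b a S b (b + int (m - 1) * b) (odd (m - 1))"
  proof (rule pwalk_run)
    fix i assume "i < m - 1"
    then have "\<not> A.len dvd int i + 1" using zdvd_not_zless[of "int i + 1" A.len] m by linarith
    then have "(int i + 1) * b \<notin> S" using first A.len_dvd by blast
    then show "b + int i * b \<notin> S \<and> b + int i * b - a \<notin> S"
      using last[of "int i + 1"] by (simp add: algebra_simps)
  qed
  moreover have "b + int (m - 1) * b = A.len * b" using m A.len_pos by (simp add: algebra_simps)
  moreover have "odd m" using \<open>odd A.len\<close> by (simp flip: m)
  ultimately have "pwalk n b a S b (A.len * b) False" by simp
  moreover have "[A.len * b = 0] (mod n)" using A.len_dvd[of A.len] by (simp add: cong_iff_dvd_diff)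
  ultimately have "pwalk n b a S b 0 False" using pwalk_cong cong_refl by blast
  from pwalk.trans[OF pwalk.sym[OF this]] pwalk.cross[of b S b n a] zero
  show ?thesis by (fastforce simp: add.commute)
qed

text \<open>Dividing by \<open>gcd b n\<close> gives \<open>a\<close> congruent to
  \<open>e * (b div gcd b n)\<close> modulo the even number \<open>A.len\<close>, and
  \<open>a\<close> is odd.\<close>

lemma odd_shift:
  assumes "even A.len" "[gcd b n * a = e * b] (mod n)"
  shows "odd e"
proof -
  have "n dvd gcd b n * a - e * b" using assms(2) by (simp add: cong_iff_dvd_diff)
  moreover have "gcd b n * a - e * b = gcd b n * (a - e * (b div gcd b n))"
    by (simp add: algebra_simps)
  moreover have "n = gcd b n * A.len" by simp
  ultimately have "gcd b n * A.len dvd gcd b n * (a - e * (b div gcd b n))" by metis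
  then have "A.len dvd a - e * (b div gcd b n)" using A.lines_pos by (subst (asm) dvd_mult_cancel_left) auto
  then have "even (a - e * (b div gcd b n))" using assms(1) dvd_trans by blast
  then show ?thesis using ab(1) by auto
qed

text \<open>The start has coordinates \<open>d - 1\<close> and \<open>k - e\<close>, the end
  \<open>0\<close> and \<open>k + 1\<close>. Since \<open>d\<close> is even and the twist
  \<open>e\<close> odd, the 2-colouring separates them.\<close>

lemma odd_walk_last_line:
  assumes per: "periodic n S" and last: "\<And>j. - a + j * b \<notin> S"
    and "even A.len" and conn: "walk_connected n b a S"
  shows "pwalk n b a S (- a + k * b) ((k + 1) * b) True"
proof -
  obtain e where e: "[gcd b n * a = e * b] (mod n)"
    "\<And>j. [- a + j * b = (gcd b n - 1) * a + (j - e) * b] (mod n)" using A.last_line by blast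
  obtain p where p: "pwalk n b a S (- a + k * b) ((k + 1) * b) p" using conn by (auto simp: walk_connected_def)
  have "[(k + 1) * b = 0 * a + (k + 1) * b] (mod n)" by simp
  from A.walk_parity[OF \<open>even A.len\<close> last per p _ _ _ _ e(2) this]
  have "p \<longleftrightarrow> odd (gcd b n - 1 + (k - e) + 0 + (k + 1))" using A.lines_pos by fastforce
  moreover have "even (gcd b n)" using even_d by (simp flip: int_d)
  ultimately have p using odd_shift[OF \<open>even A.len\<close> e(1)] by simp
  then show ?thesis using p by simp
qed

section \<open>At least three \<open>a\<close>-cycles and four \<open>b\<close>-cycles\<close>

lemma Q2_switching_general:
  assumes "3 \<le> c" "4 \<le> d"
  shows "Q2_switching n a b"
proof -
  obtain e where e: "[gcd b n * a = e * b] (mod n)"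
    "\<And>j. [- a + j * b = (gcd b n - 1) * a + (j - e) * b] (mod n)" using A.last_line by blast
  obtain S where S: "periodic n S" "sparse a b S" "walk_connected n a b S" "walk_connected n b a S"
    "pwalk n a b S 0 (a + b) True" and zero: "0 \<in> S" and one: "a + b \<in> S"
    and last: "\<And>j. - a + j * b \<notin> S" and first: "\<And>j. j * b \<in> S \<Longrightarrow> n dvd j * b"
    and pen: "- 2 * a + b \<notin> S"
  proof (cases "c < d")
    case True
    let ?S = "corners n a b c (d - 1)"
    have N: "int (d - 1) + 1 = gcd b n" using d_pos int_d by linarith
    have per: "x \<in> ?S \<longleftrightarrow> y \<in> ?S" if "[x = y] (mod n)" for x y using periodicD[OF periodic_corners that] .
    have "0 \<in> ?S" using zero_mem_corners c_pos assms by simp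
    moreover have "a + b \<in> ?S" using cornersI[of 1 "d - 1" a c b n] assms by (simp add: zigzag_row_def)
    moreover have "- a + j * b \<notin> ?S" for j
      using per[OF e(2)] A.not_mem_corners[of "d - 1" "gcd b n - 1"] N by auto
    moreover have "n dvd j * b" if "j * b \<in> ?S" for j
      using A.mem_corners[of 0 "d - 1" j c] that N assms n(1) by (simp add: zigzag_row_def)
    \<comment> \<open>This corner is on line \<open>d - 2\<close>, whose square has height
      \<open>c - 1\<close>. Equality would make \<open>c\<close> divide 2.\<close>
    moreover have "- 2 * a + b \<notin> ?S"
    proof
      assume m: "- 2 * a + b \<in> ?S"
      have "[- 2 * a + b = (gcd b n - 2) * a + (1 - e) * b] (mod n)"
        using e(2)[of 1] by (simp add: cong_iff_dvd_diff algebra_simps)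
      with m have "(gcd b n - 2) * a + (1 - e) * b \<in> ?S" using per by blast
      moreover have "0 \<le> gcd b n - 2" "gcd b n - 2 < gcd b n" "int (d - 1) \<le> gcd b n" "nat (gcd b n - 2) = d - 2"
        using N assms int_d by linarith+
      ultimately have "n dvd (1 - e - zigzag_row c (d - 2)) * b" using A.mem_corners by metis
      moreover have "zigzag_row c (d - 2) = int c - 1"
      proof (cases "c \<le> d - 2")
        case True
        moreover have "odd (d - 2 - c)" using True odd_c even_d assms(2) by presburger
        ultimately show ?thesis by (rule zigzag_row_top)
      next
        case False
        then have "d - 2 = c - 1" using \<open>c < d\<close> odd_c even_d by presburger
        then show ?thesis using c_pos by (simp add: zigzag_row_def)
      qed
      ultimately have "n dvd (2 - int c - e) * b" by (simp add: algebra_simps)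
      from dvd_add[OF this e(1)[unfolded cong_iff_dvd_diff, THEN dvd_minus_iff[THEN iffD2]]]
      have "[(2 - int c) * b + 0 * a = 0 * b + gcd b n * a] (mod n)"
        by (simp add: cong_iff_dvd_diff algebra_simps)
      then have "[2 - int c = 0] (mod gcd a n)" by (rule B.line_index)
      then have "int c dvd 2 - int c" by (simp add: cong_iff_dvd_diff int_c)
      from dvd_add[OF this dvd_refl] have "int c dvd 2" by simp
      then show False using assms(1) zdvd_not_zless[of 2 "int c"] by simp
    qed
    ultimately show ?thesis using that connected_few_odd[OF True] assms(1) by blast
  next
    case False
    then have "d < c" using odd_c even_d by (metis linorder_neqE_nat)
    let ?S = "corners n b a (d - 1) c"
    have mem: "\<exists>g<c. [x = zigzag_row (d - 1) g * a + int g * b] (mod n)" if "x \<in> ?S" for x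
      using that by (auto simp: corners_def add.commute)
    have zigzag_row: "0 \<le> zigzag_row (d - 1) g \<and> zigzag_row (d - 1) g \<le> int d - 2 \<and> (zigzag_row (d - 1) g = 0 \<longrightarrow> g = 0)" for g
    proof (cases "g < d - 1")
      case True
      then have "zigzag_row (d - 1) g = int g" by (simp add: zigzag_row_def)
      then show ?thesis using True by linarith
    next
      case False
      then show ?thesis using zigzag_row_ge[of "d - 1" g] assms(2) by linarith
    qed
    have "0 \<in> ?S" using zero_mem_corners c_pos assms by simp
    moreover have z1: "zigzag_row (d - 1) 1 = 1"
    proof -
      have "1 < d - 1" using assms by linarith
      then show ?thesis by (simp add: zigzag_row_def)
    qed
    moreover have "a + b \<in> ?S" using cornersI[of 1 c b "d - 1" a n] assms(1) unfolding z1 by (simp add: add.commute)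
    \<comment> \<open>The heights stay between \<open>0\<close> and \<open>d - 2\<close>, so none is
      congruent to -1 modulo \<open>d\<close>.\<close>
    moreover have "- a + j * b \<notin> ?S" for j
    proof
      assume "- a + j * b \<in> ?S"
      then obtain g where "[(- 1) * a + j * b = zigzag_row (d - 1) g * a + int g * b] (mod n)" using mem by fastforce
      then have "[- 1 = zigzag_row (d - 1) g] (mod gcd b n)" by (rule A.line_index)
      then have "int d dvd zigzag_row (d - 1) g + 1" by (simp add: cong_iff_dvd_diff int_d dvd_diff_commute[of _ "-1"])
      then show False using zdvd_not_zless[of "zigzag_row (d - 1) g + 1" "int d"] zigzag_row[of g] by linarith
    qed
    moreover have "n dvd j * b" if j: "j * b \<in> ?S" for j
    proof -
      obtain g where g: "[0 * a + j * b = zigzag_row (d - 1) g * a + int g * b] (mod n)" using mem[OF j] by auto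
      then have "0 = zigzag_row (d - 1) g"
        by (rule A.index_unique) (use zigzag_row[of g] int_d assms in linarith)+
      then have "g = 0" "zigzag_row (d - 1) g = 0" using zigzag_row[of g] by simp_all
      then show ?thesis using g by (simp add: cong_iff_dvd_diff)
    qed
    moreover have "- 2 * a + b \<notin> ?S"
    proof
      assume "- 2 * a + b \<in> ?S"
      then obtain g where g: "g < c" "[- 2 * a + 1 * b = zigzag_row (d - 1) g * a + int g * b] (mod n)" using mem by fastforce
      then have "[1 * b + (- 2) * a = int g * b + zigzag_row (d - 1) g * a] (mod n)" by (simp add: add.commute)
      then have "1 = int g" by (rule B.index_unique) (use g(1) int_c assms in linarith)+
      then have "g = 1" by simp
      then have "zigzag_row (d - 1) g = 1" using z1 by simp
      then have "[- 2 = 1] (mod gcd b n)" using A.line_index[OF g(2)] by simp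
      then have "int d dvd 3" by (simp add: cong_iff_dvd_diff int_d)
      then show False using assms(2) zdvd_not_zless[of 3 "int d"] by simp
    qed
    ultimately show ?thesis using that connected_few_even[OF \<open>d < c\<close>] by blast
  qed
  show ?thesis
  proof (cases "even A.len")
    case False
    then have "pwalk n b a S 0 (a + b) True" by (intro odd_walk_first_line S(1) zero last first)
    then show ?thesis unfolding Q2_switching_def using S zero by (intro exI[of _ S] exI[of _ 0]) simp
  next
    case True
    \<comment> \<open>The corners \<open>b - a\<close> and \<open>2 * b\<close> hang on the switched
      squares at \<open>0\<close> and \<open>a + b\<close>: the walk \<open>b - a\<close>,
      \<open>b\<close>, \<open>0\<close>, ..., \<open>a + b\<close>, \<open>a + 2 * b\<close>,
      \<open>2 * b\<close> adds four edges to the odd walk from \<open>0\<close> to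
      \<open>a + b\<close>.\<close>
    let ?w = "b - a"
    have mem: "b - a \<notin> S" "2 * b - a \<notin> S" "- a \<notin> S" "b \<notin> S" "2 * b \<notin> S"
      using last[of 1] last[of 2] last[of 0] first[of 1] first[of 2] not_dvd b2 by auto
    have "pwalk n b a S (- a + 1 * b) ((1 + 1) * b) True"
      by (rule odd_walk_last_line[OF S(1) last True S(4)])
    then have "pwalk n b a S ?w (?w + a + b) True" by (simp add: algebra_simps)
    moreover have "pwalk n a b S ?w (?w + a + b) True"
    proof -
      have 1: "pwalk n a b S (b - a) b True" using pwalk.straight[of "b - a" S b n a] mem by simp
      have 2: "pwalk n a b S 0 b True" using pwalk.cross[of 0 S a n b] zero by simp
      have 3: "pwalk n a b S (a + b) (a + b + b) True" using pwalk.cross[of "a + b" S a n b] one by simp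
      have 4: "pwalk n a b S (2 * b) (a + b + b) True" using pwalk.straight[of "2 * b" S b n a] mem
        by (simp add: algebra_simps)
      from pwalk.trans[OF pwalk.trans[OF pwalk.trans[OF pwalk.trans[OF 1 pwalk.sym[OF 2]] S(5)] 3] pwalk.sym[OF 4]]
      show ?thesis by simp
    qed
    moreover have "{?w, ?w + a, ?w - a, ?w + b, ?w - b} \<inter> S = {}"
    proof -
      have "?w - a = - 2 * a + b" "?w + b = 2 * b - a" by simp_all
      then show ?thesis using mem pen by simp
    qed
    ultimately show ?thesis unfolding Q2_switching_def using S by blast
  qed
qed

end

section \<open>A single \<open>a\<close>-cycle\<close>

lemma mem_corners_single: "x \<in> corners n u v 1 1 \<longleftrightarrow> n dvd x"
  by (simp add: corners_def zigzag_row_def cong_iff_dvd_diff)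

context odd_even_jumps
begin

lemma Q2_switching_a_generates:
  assumes "c = 1" and t: "[b = int t * a] (mod n)" "0 < t" "2 * int t < n"
  shows "Q2_switching n a b"
proof -
  have "c < d" using assms(1) d_pos by simp
  \<comment> \<open>With \<open>M = 1\<close> the heights are 0, -1, 0, -1, ..., ending with
    0.\<close>
  let ?S = "corners n a b 1 (d - 1)"
  note S = connected_few_odd[OF \<open>c < d\<close>, unfolded assms(1)]
  have ga: "gcd a n = 1" using assms(1) int_c by simp
  have N: "int (d - 1) + 1 = gcd b n" using d_pos int_d by linarith
  have per: "x \<in> ?S \<longleftrightarrow> y \<in> ?S" if "[x = y] (mod n)" for x y using periodicD[OF periodic_corners that] .
  obtain e where e: "[gcd b n * a = e * b] (mod n)"
    "\<And>j. [- a + j * b = (gcd b n - 1) * a + (j - e) * b] (mod n)" using A.last_line by blast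
  have zero: "0 \<in> ?S" using zero_mem_corners d_pos by simp
  have last: "- a + j * b \<notin> ?S" for j
    using per[OF e(2)] A.not_mem_corners[of "d - 1" "gcd b n - 1"] N by auto
  have first: "n dvd j * b" if "j * b \<in> ?S" for j
    using A.mem_corners[of 0 "d - 1" j 1] that N d_pos n(1) by (simp add: zigzag_row_def)
  have dvd_a: "n dvd i * a \<longleftrightarrow> n dvd i" for i using B.len_dvd[of i] ga by simp
  have nd: "\<not> n dvd x" if "[x = i * a] (mod n)" "- n < i" "i < n" "i \<noteq> 0" for x i
  proof
    assume "n dvd x"
    then have "n dvd i * a" using that(1) by (metis cong_dvd_iff)
    then have "n dvd i" by (simp add: dvd_a)
    then show False using that(2-4) zdvd_not_zless[of i n] zdvd_not_zless[of "- i" n] by (cases "0 < i") auto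
  qed
  have "even t"
  proof -
    have "n dvd b - int t * a" using t(1) by (simp add: cong_iff_dvd_diff)
    then have "even (b - int t * a)" using n(2) dvd_trans by blast
    then show ?thesis using ab by simp
  qed
  have t2: "2 * int t + 1 < n"
  proof -
    have "2 * int t + 1 \<noteq> n" using n(2) by (metis even_mult_iff even_plus_one_iff dvd_triv_left)
    then show ?thesis using t(3) by linarith
  qed
  \<comment> \<open>Only the square at \<open>0\<close> is switched here. The vertices met and their
    translates by \<open>- b\<close> are multiples \<open>i * a\<close> with
    \<open>- n < i < 0\<close>, by \<open>2 * int t + 1 < n\<close>; so the run reaches
    \<open>0\<close> undisturbed.\<close>
  have run: "pwalk n a b (corners n a b 1 1) (- (int k * a) - b) 0 (odd (t + k))" if "k \<le> 1" for k
  proof -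
    have "pwalk n a b (corners n a b 1 1) (- (int k * a) - b) (- (int k * a) - b + int (t + k) * a) (odd (t + k))"
    proof (rule pwalk_run)
      fix i assume i: "i < t + k"
      have "[- (int k * a) - b + int i * a = (int i - int k - int t) * a] (mod n)"
        "[- (int k * a) - b + int i * a - b = (int i - int k - 2 * int t) * a] (mod n)"
        using t(1) dvd_mult[of n "b - int t * a" "-1"] dvd_mult[of n "b - int t * a" "-2"]
        by (simp_all add: cong_iff_dvd_diff algebra_simps)
      then show "- (int k * a) - b + int i * a \<notin> corners n a b 1 1 \<and> - (int k * a) - b + int i * a - b \<notin> corners n a b 1 1"
        unfolding mem_corners_single using i that t2 t(2) by (intro conjI; elim nd) auto
    qed
    moreover have "[- (int k * a) - b + int (t + k) * a = 0] (mod n)"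
      using t(1) dvd_minus_iff[of n "b - int t * a"] by (simp add: cong_iff_dvd_diff algebra_simps)
    ultimately show ?thesis using pwalk_cong cong_refl by blast
  qed
  define h where "h = (d - 2) div 2"
  have h: "d - 1 = 1 + 2 * h" using even_d d_pos by (simp add: h_def)
  have le: "int 1 + 2 * int h \<le> gcd b n" using h N by linarith
  show ?thesis
  proof (cases "even A.len")
    case True
    \<comment> \<open>Its opposite corner is \<open>0\<close>. The two lie on lines
      \<open>d - 1\<close> and \<open>0\<close>, off the prolonged lines, so the walk of
      \<open>t + 1\<close> steps keeps its parity.\<close>
    let ?w = "- a - b"
    have "pwalk n b a ?S (- a + (- 1) * b) ((- 1 + 1) * b) True"
      by (rule odd_walk_last_line[OF S(1) last True S(4)])
    then have "pwalk n b a ?S ?w (?w + a + b) True" by simp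
    moreover have "pwalk n a b ?S ?w (?w + a + b) True"
    proof -
      have w: "pwalk n a b (corners n a b 1 1) (- a - b) 0 True" using run[of 1] \<open>even t\<close> by simp
      have "pwalk n a b (corners n a b 1 (1 + 2 * h)) (- a - b) 0 True"
      proof (rule A.zigzag_family_walk[OF _ le b2 w])
        fix w i j assume w: "w \<in> {- a - b, 0}" and i: "int 1 \<le> i" "i < int 1 + 2 * int h"
        have l: "0 < i" "i < gcd b n - 1" "i < gcd b n" using i h N by linarith+
        from w consider "w = - a + (- 1) * b" | "w = 0 * a + 0 * b" by auto
        then show "\<not> [w = i * a + j * b] (mod n)"
        proof cases
          case 1
          have "\<not> [i * a + j * b = (gcd b n - 1) * a + (- 1 - e) * b] (mod n)"
            by (rule A.lines_distinct) (use l in auto)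
          then show ?thesis unfolding 1 using e(2)[of "- 1"] cong_trans cong_sym by blast
        next
          case 2
          then show ?thesis using A.lines_distinct[OF _ l(1,3), of 0 j] by simp
        qed
      qed simp
      then show ?thesis unfolding h by simp
    qed
    moreover have "{?w, ?w + a, ?w - a, ?w + b, ?w - b} \<inter> ?S = {}"
    proof -
      \<comment> \<open>The square on line \<open>d - 2\<close> has height 0. A coincidence would
        make \<open>n\<close> divide \<open>d + t\<close>; but \<open>d\<close> divides
        \<open>t\<close>, so \<open>d + t\<close> is at most \<open>2 * t\<close>, less than
        \<open>n\<close>.\<close>
      have "- 2 * a - b \<notin> ?S"
      proof
        assume m: "- 2 * a - b \<in> ?S"
        have "[- 2 * a - b = (gcd b n - 2) * a + (- 1 - e) * b] (mod n)"
          using e(2)[of "- 1"] by (simp add: cong_iff_dvd_diff algebra_simps)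
        with m have "(gcd b n - 2) * a + (- 1 - e) * b \<in> ?S" using per by blast
        moreover have "0 \<le> gcd b n - 2" "gcd b n - 2 < gcd b n" "int (d - 1) \<le> gcd b n" "nat (gcd b n - 2) = d - 2"
          using N d_pos int_d by linarith+
        ultimately have "n dvd (- 1 - e - zigzag_row 1 (d - 2)) * b" using A.mem_corners by metis
        moreover have "zigzag_row 1 (d - 2) = 0" using zigzag_row_top[of 1 "d - 2"] even_d d_pos
          by (cases "d = 2") (auto simp: zigzag_row_def)
        ultimately have "n dvd (- 1 - e) * b" by simp
        from dvd_diff[OF dvd_diff[OF e(1)[unfolded cong_iff_dvd_diff] this] t(1)[unfolded cong_iff_dvd_diff]]
        have "n dvd (gcd b n + int t) * a" by (simp add: algebra_simps)
        then have "n dvd gcd b n + int t" by (simp add: dvd_a)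
        moreover have "gcd b n dvd int t"
        proof -
          have "n dvd b - int t * a" using t(1) by (simp add: cong_iff_dvd_diff)
          then have "gcd b n dvd b - int t * a" by (meson dvd_trans gcd_dvd2)
          then have "gcd b n dvd int t * a" by (metis dvd_diff_commute dvd_diff_right_iff gcd_dvd1)
          moreover have "coprime n a" using ga by (simp add: coprime_iff_gcd_eq_1 gcd.commute)
          then have "coprime (gcd b n) a" by (rule coprime_divisors[OF gcd_dvd2 dvd_refl])
          ultimately show ?thesis by (simp add: coprime_dvd_mult_left_iff)
        qed
        then have "gcd b n \<le> int t" using t(2) by (simp add: zdvd_imp_le)
        ultimately show False using t(2,3) A.lines_pos zdvd_not_zless[of "gcd b n + int t" n] by linarith
      qed
      moreover have "- a - b \<notin> ?S" "- b \<notin> ?S" "- a \<notin> ?S" "- a - 2 * b \<notin> ?S"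
        using last[of "- 1"] last[of 0] last[of "- 2"] first[of "- 1"] not_dvd by auto
      moreover have eq: "?w + a = - b" "?w - a = - 2 * a - b" "?w + b = - a" "?w - b = - a - 2 * b" by simp_all
      ultimately show ?thesis unfolding eq by blast
    qed
    ultimately show ?thesis unfolding Q2_switching_def using S(1-4) by blast
  next
    case False
    have B: "pwalk n b a ?S 0 (a + b) True"
      by (intro odd_walk_first_line S(1) zero last first False)
    have A: "pwalk n a b ?S 0 (a + b) True"
    proof (cases "d = 2")
      case True
      have r: "pwalk n a b ?S a (a + int (t - 1) * a) (odd (t - 1))"
      proof (rule pwalk_run)
        fix i assume i: "i < t - 1"
        have "[a + int i * a = (int i + 1) * a] (mod n)" "[a + int i * a - b = (int i + 1 - int t) * a] (mod n)"
          using t(1) by (simp_all add: cong_iff_dvd_diff algebra_simps dvd_diff_commute)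
        then show "a + int i * a \<notin> ?S \<and> a + int i * a - b \<notin> ?S"
          using i t by (simp add: True mem_corners_single[simplified]) (intro conjI; elim nd; auto)
      qed
      have e: "[a + int (t - 1) * a = b] (mod n)"
        using t by (simp add: cong_iff_dvd_diff algebra_simps dvd_diff_commute)
      have "odd (t - 1)" using \<open>even t\<close> t(2) by simp
      then have 1: "pwalk n a b ?S a b True" using pwalk_cong[OF r cong_refl e] by simp
      have 2: "pwalk n a b ?S 0 b True" using pwalk.cross[of 0 ?S a n b] zero by simp
      have 3: "pwalk n a b ?S a (a + b) True" using pwalk.cross[of a ?S a n b] zero by simp
      from pwalk.trans[OF pwalk.trans[OF 2 pwalk.sym[OF 1]] 3] show ?thesis by simp
    next
      case False
      then have d4: "4 \<le> d" using even_d d_pos by presburger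
      have w: "pwalk n a b (corners n a b 1 1) (- b) 0 False" using run[of 0] \<open>even t\<close> by simp
      have "pwalk n a b (corners n a b 1 (1 + 2 * h)) (- b) 0 False"
      proof (rule A.zigzag_family_walk[OF _ le b2 w])
        fix w i j assume w: "w \<in> {- b, 0}" and i: "int 1 \<le> i" "i < int 1 + 2 * int h"
        have l: "0 < i" "i < gcd b n" using i h N by linarith+
        from w consider "w = 0 * a + (- 1) * b" | "w = 0 * a + 0 * b" by auto
        then show "\<not> [w = i * a + j * b] (mod n)"
          using A.lines_distinct[OF _ l, of "- 1" j] A.lines_distinct[OF _ l, of 0 j] by cases simp_all
      qed simp
      then have 1: "pwalk n a b ?S (- b) 0 False" unfolding h by simp
      have "- b \<notin> ?S" "- b - b \<notin> ?S" using first[of "- 1"] first[of "- 2"] not_dvd b2 by auto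
      then have 2: "pwalk n a b ?S (- b) (- b + a) True" by (rule pwalk.straight)
      have "- b + a \<in> ?S" using cornersI[of 1 "d - 1" a 1 b n] d4 by (simp add: zigzag_row_def)
      then have 3: "pwalk n a b ?S (- b + a) a True" using pwalk.cross[of "- b + a" ?S a n b] by simp
      have 4: "pwalk n a b ?S a (a + b) True" using pwalk.cross[of a ?S a n b] zero by simp
      from pwalk.trans[OF pwalk.trans[OF pwalk.trans[OF pwalk.sym[OF 1] 2] 3] 4] show ?thesis by simp
    qed
    show ?thesis unfolding Q2_switching_def using S(1-4) zero A B
      by (intro exI[of _ ?S] exI[of _ 0]) simp
  qed
qed

section \<open>Two \<open>b\<close>-cycles and at least three \<open>a\<close>-cycles\<close>

lemma Q2_switching_two_b_lines:
  assumes "d = 2" "3 \<le> c" and \<rho>: "[int \<rho> * b = 2 * a] (mod n)" "odd \<rho>" "int \<rho> < A.len"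
  shows "Q2_switching n a b"
proof -
  have "d < c" using assms(1,2) by simp
  let ?S = "corners n b a 1 c"
  have dd: "d - 1 = 1" using assms(1) by simp
  note S = connected_few_even[OF \<open>d < c\<close>, unfolded dd]
  have zero: "0 \<in> ?S" using zero_mem_corners c_pos by simp
  define h where "h = (c - 1) div 2"
  have h: "c = 1 + 2 * h" using odd_c by (simp add: h_def)
  have le: "int 1 + 2 * int h \<le> gcd a n" using h int_c by linarith
  \<comment> \<open>The odd residues form the second \<open>b\<close>-cycle. Its only switched edge
    starts at \<open>a\<close>, where this run of \<open>\<rho>\<close> steps ends.\<close>
  have run: "pwalk n b a (corners n b a 1 1) (- a) (- a + int \<rho> * b) (odd \<rho>)"
  proof (rule pwalk_run)
    fix i assume i: "i < \<rho>"
    have "odd (- a + int i * b)" using ab by simp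
    then have "\<not> n dvd - a + int i * b" using n(2) dvd_trans by blast
    moreover have "\<not> n dvd - a + int i * b - a"
    proof
      assume "n dvd - a + int i * b - a"
      moreover have "n dvd int \<rho> * b - 2 * a" using \<rho>(1) by (simp add: cong_iff_dvd_diff)
      ultimately have "n dvd (int \<rho> * b - 2 * a) - (- a + int i * b - a)" by (rule dvd_diff[rotated])
      then have "n dvd (int \<rho> - int i) * b" by (simp add: algebra_simps)
      then have "A.len dvd int \<rho> - int i" by (simp add: A.len_dvd)
      then show False using zdvd_not_zless[of "int \<rho> - int i" A.len] i \<rho>(3) by simp
    qed
    ultimately show "- a + int i * b \<notin> corners n b a 1 1 \<and> - a + int i * b - a \<notin> corners n b a 1 1"
      by (simp only: mem_corners_single not_False_eq_True simp_thms)
  qed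
  have e: "[- a + int \<rho> * b = a] (mod n)" using \<rho>(1) by (simp add: cong_iff_dvd_diff)
  have 1: "pwalk n b a (corners n b a 1 1) (- a) a True" using pwalk_cong[OF run cong_refl e] \<rho>(2) by simp
  have 2: "pwalk n b a (corners n b a 1 1) 0 a True"
    using pwalk.cross[of 0 "corners n b a 1 1" b n a] by (simp add: mem_corners_single[simplified])
  have w: "pwalk n b a (corners n b a 1 1) 0 (- a) False" using pwalk.trans[OF 2 pwalk.sym[OF 1]] by simp
  have "pwalk n b a (corners n b a 1 (1 + 2 * h)) 0 (- a) False"
  proof (rule B.zigzag_family_walk[OF _ le a2 w])
    fix w i j assume w: "w \<in> {0, - a}" and i: "int 1 \<le> i" "i < int 1 + 2 * int h"
    have l: "0 < i" "i < gcd a n" using i le by linarith+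
    from w consider "w = 0 * b + (- 1) * a" | "w = 0 * b + 0 * a" by auto
    then show "\<not> [w = i * b + j * a] (mod n)"
      using B.lines_distinct[OF _ l, of "- 1" j] B.lines_distinct[OF _ l, of 0 j] by cases simp_all
  qed simp
  then have 1: "pwalk n b a ?S 0 (- a) False" by (simp only: h[symmetric])
  have m0: "n dvd j * a" if "j * a \<in> ?S" for j
    using B.mem_corners[of 0 c j 1] that int_c c_pos n(1) by (simp add: zigzag_row_def)
  have "- a \<notin> ?S" "- a - a \<notin> ?S" using m0[of "- 1"] m0[of "- 2"] not_dvd a2 by auto
  then have 2: "pwalk n b a ?S (- a) (- a + b) True" by (rule pwalk.straight)
  have "- a + b \<in> ?S" using cornersI[of 1 c b 1 a n] assms(2) by (simp add: zigzag_row_def)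
  then have 3: "pwalk n b a ?S (- a + b) b True" using pwalk.cross[of "- a + b" ?S b n a] by simp
  have 4: "pwalk n b a ?S b (b + a) True" using pwalk.cross[of b ?S b n a] zero by simp
  from pwalk.trans[OF pwalk.trans[OF pwalk.trans[OF 1 2] 3] 4]
  have "pwalk n b a ?S 0 (a + b) True" by (simp add: add.commute)
  then show ?thesis unfolding Q2_switching_def using S zero
    by (intro exI[of _ ?S] exI[of _ 0]) simp
qed

end

section \<open>Choice of the sign and conclusion\<close>

context odd_even_jumps
begin

lemma uminus_jump: "odd_even_jumps n a (- b)"
  using n ab cop a2 b2 by unfold_locales simp_all

text \<open>For \<open>c = 1\<close> the sign change replaces \<open>t\<close> by
  \<open>n - t\<close>, and one of these is below \<open>n / 2\<close> because \<open>2 * b\<close>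
  is nonzero. For \<open>d = 2\<close> it replaces \<open>r\<close> by \<open>A.len - r\<close>; if
  \<open>r\<close> is even, \<open>odd_shift\<close> makes \<open>A.len\<close> odd, so the other
  one is odd.\<close>

lemma Q2_switching_up_to_sign: "Q2_switching n a b \<or> Q2_switching n a (- b)"
proof -
  interpret neg: odd_even_jumps n a "- b" by (rule uminus_jump)
  have neg_d: "neg.d = d" by (simp add: d_def neg.d_def)
  have "c = 1 \<or> 3 \<le> c" using odd_c by presburger
  moreover have "d = 2 \<or> 4 \<le> d" using even_d d_pos by presburger
  ultimately consider "3 \<le> c" "4 \<le> d" | "c = 1" | "3 \<le> c" "d = 2" by blast
  then show ?thesis
  proof cases
    case 1
    then show ?thesis using Q2_switching_general by simp
  next
    case 2
    then have "coprime a n" using int_c by (simp add: coprime_iff_gcd_eq_1)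
    then obtain x where x: "[a * x = 1] (mod n)" using cong_solve_coprime_int by blast
    define t where "t = nat ((b * x) mod n)"
    have it: "int t = (b * x) mod n" using n(1) by (simp add: t_def)
    have "[int t * a = b * x * a] (mod n)" unfolding it by (simp add: cong_def mod_simps)
    also have "[b * x * a = b * 1] (mod n)"
      using cong_scalar_left[OF x, of b] by (simp add: mult_ac)
    finally have t: "[b = int t * a] (mod n)" by (simp add: cong_sym_eq)
    have "t \<noteq> 0"
    proof
      assume "t = 0"
      then show False using t not_dvd by (simp add: cong_iff_dvd_diff)
    qed
    have tn: "int t < n" unfolding it using n(1) by simp
    have "2 * int t \<noteq> n"
    proof
      assume "2 * int t = n"
      then have "[2 * b = n * a] (mod n)" using cong_scalar_left[OF t, of 2] by (simp flip: mult.assoc)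
      then show False using b2 by (simp add: cong_def mod_eq_0_iff_dvd)
    qed
    then consider "2 * int t < n" | "n < 2 * int t" by linarith
    then show ?thesis
    proof cases
      case 1
      then show ?thesis using Q2_switching_a_generates[OF 2 t] \<open>t \<noteq> 0\<close> by simp
    next
      case lt: 2
      let ?t = "nat (n - int t)"
      have i: "int ?t = n - int t" using tn by simp
      have "[- b = int ?t * a] (mod n)"
      proof -
        have "n dvd (b - int t * a) + n * a" using t by (simp add: cong_iff_dvd_diff)
        then have "n dvd - ((b - int t * a) + n * a)" by (simp only: dvd_minus_iff)
        then show ?thesis unfolding i by (simp add: cong_iff_dvd_diff algebra_simps)
      qed
      moreover have "0 < ?t" using tn by simp
      moreover have "2 * int ?t < n" unfolding i using lt by simp
      ultimately have "Q2_switching n a (- b)"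
        by (rule neg.Q2_switching_a_generates[OF 2])
      then show ?thesis ..
    qed
  next
    case 3
    obtain e where e: "[gcd b n * a = e * b] (mod n)" using A.line_shift by blast
    then have e2: "[2 * a = e * b] (mod n)" using 3(2) int_d by simp
    define r where "r = nat (e mod A.len)"
    have ir: "int r = e mod A.len" using A.len_pos by (simp add: r_def)
    have lt: "int r < A.len" unfolding ir using A.len_pos by simp
    have "n dvd (e mod A.len - e) * b" by (simp add: A.len_dvd mod_eq_dvd_iff[symmetric])
    then have "[int r * b = e * b] (mod n)" unfolding ir by (simp add: cong_iff_dvd_diff algebra_simps)
    then have r: "[int r * b = 2 * a] (mod n)" using e2 cong_trans cong_sym by blast
    show ?thesis
    proof (cases "odd r")
      case True
      then show ?thesis using Q2_switching_two_b_lines[OF 3(2,1) r _ lt] by simp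
    next
      case False
      then have "odd A.len" using odd_shift[of "int r"] r 3(2) int_d cong_sym by fastforce
      have "r \<noteq> 0"
      proof
        assume "r = 0"
        then show False using r a2 by (simp add: cong_iff_dvd_diff)
      qed
      let ?r = "nat (A.len - int r)"
      have i: "int ?r = A.len - int r" using lt by simp
      have "n dvd A.len * b" using A.len_dvd by simp
      have "[int ?r * - b = 2 * a] (mod n)"
      proof -
        have "n dvd (int r * b - 2 * a) - A.len * b"
          using r \<open>n dvd A.len * b\<close> by (simp add: cong_iff_dvd_diff dvd_diff)
        then show ?thesis unfolding i by (simp add: cong_iff_dvd_diff algebra_simps)
      qed
      moreover have "odd ?r" using False \<open>odd A.len\<close> lt by (simp add: even_nat_iff)
      moreover have "int ?r < n div gcd (- b) n" unfolding i using \<open>r \<noteq> 0\<close> by simp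
      ultimately have "Q2_switching n a (- b)"
        by (rule neg.Q2_switching_two_b_lines[OF 3(2)[folded neg_d] 3(1)])
      then show ?thesis ..
    qed
  qed
qed

end

text \<open>The gcd divides the difference of the ends of every edge, hence also 1 along a walk from
  \<open>0\<close> to \<open>1\<close>.\<close>

lemma connected_Circ_coprime:
  assumes "connected_graph (Circ n {a, b})" "2 \<le> n"
  shows "gcd (gcd (int a) (int b)) (int n) = 1"
proof -
  let ?g = "gcd (gcd (int a) (int b)) (int n)"
  have g: "?g dvd int a" "?g dvd int b" "?g dvd int n" by (meson dvd_trans gcd_dvd1 gcd_dvd2)+
  have "n > 0" using assms(2) by simp
  have "(0, 1) \<in> (adj (edges (Circ n {a, b})))\<^sup>*"
    using assms by (simp add: connected_graph_def Circ_def)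
  then have "?g dvd int 1 - int 0"
  proof (induction rule: rtrancl_induct)
    case base
    then show ?case by simp
  next
    case (step x y)
    have key: "?g dvd int y - int x" if "{x, y} \<in> jump_edges (int n) (int j)" "?g dvd int j" for j x y
    proof -
      obtain z where z: "{x, y} = {nat (z mod int n), nat ((z + int j) mod int n)}"
        using \<open>{x, y} \<in> _\<close> by (auto simp: jump_edges_def)
      have "int (nat (z mod int n)) = z mod int n" "int (nat ((z + int j) mod int n)) = (z + int j) mod int n"
        using \<open>0 < n\<close> by simp_all
      moreover have "[z mod int n = z] (mod ?g)" "[(z + int j) mod int n = z] (mod ?g)"
      proof -
        show "[z mod int n = z] (mod ?g)" using g(3) by (metis cong_def mod_mod_cancel)
        have "[(z + int j) mod int n = z + int j] (mod ?g)" using g(3) by (metis cong_def mod_mod_cancel)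
        also have "[z + int j = z] (mod ?g)" using that(2) by (simp add: cong_iff_dvd_diff)
        finally show "[(z + int j) mod int n = z] (mod ?g)" .
      qed
      ultimately have "[int x = z] (mod ?g)" "[int y = z] (mod ?g)" using z by (auto simp: doubleton_eq_iff)
      then have "[int y = int x] (mod ?g)" using cong_sym cong_trans by blast
      then show ?thesis by (simp add: cong_iff_dvd_diff)
    qed
    have "?g dvd int y - int x"
      using step.hyps(2) key[of x y a] key[of x y b] g(1,2)
      unfolding adj_def edges_Circ[OF \<open>n > 0\<close>] by auto
    from dvd_add[OF this step.IH] show ?case by simp
  qed
  then have "?g dvd 1" by simp
  moreover have "0 \<le> ?g" by simp
  ultimately show ?thesis by (simp only: zdvd1_eq abs_of_nonneg)
qed

theorem theorem2p13:
  fixes n a b :: nat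
  assumes "even n"
    and "four_regular_jumps n a b"
    and "connected_graph (Circ n {a, b})"
    and "even a \<noteq> even b"
  shows "\<exists>H1 H2. hamilton_decomposition (Circ n {a, b}) H1 H2
                \<and> property_Q2 (Circ n {a, b}) H1 H2"
proof -
  have n2: "2 \<le> n" using assms(2) unfolding four_regular_jumps_def by auto
  have main: "\<exists>H1 H2. hamilton_decomposition (Circ n {a, b}) H1 H2 \<and> property_Q2 (Circ n {a, b}) H1 H2"
    if "odd a" "even b" "\<not> [2 * a = 0] (mod n)" "\<not> [2 * b = 0] (mod n)" "connected_graph (Circ n {a, b})" for a b
  proof -
    have "\<not> n dvd 2 * a" "\<not> n dvd 2 * b" using that(3,4) by (simp_all add: cong_0_iff)
    then have 2: "\<not> int n dvd 2 * int a" "\<not> int n dvd 2 * int b"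
      by (metis int_dvd_int_iff of_nat_mult of_nat_numeral)+
    interpret odd_even_jumps "int n" "int a" "int b"
      by unfold_locales (use n2 assms(1) that(1,2) 2 connected_Circ_coprime[OF that(5) n2] in simp_all)
    from Q2_switching_up_to_sign show ?thesis
      by (rule disjE; elim Q2_switching_imp) (use n2 assms(1) that(1,2) 2 in simp_all)
  qed
  show ?thesis
  proof (cases "even a")
    case False
    then show ?thesis using main[of a b] assms by (auto simp: four_regular_jumps_def)
  next
    case True
    then show ?thesis using main[of b a] assms by (auto simp: four_regular_jumps_def insert_commute)
  qed
qed

end
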